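(* Suppose that the skew product $F:\Sigma\to\Sigma$, $F(\gamma,y)=(\sigma(\gamma),G(\gamma,y))$, satisfies (G1) and (G2), and let $\mu_0$ be the unique $F$-invariant probability measure in $S^\infty$. Then there exists a constant $0<\tau_2<1$ such that, for every function $\psi:\Sigma\to\mathbb R$ which is constant along fibers (i.e. $\psi(\gamma,y)=\psi(\gamma)$) with $\psi\in L^1(m)$, and for every Lipschitz function $\varphi\in \mathrm H(\Sigma)$, $$\left|\int_\Sigma(\psi\circ F^n)\,\varphi\,d\mu_0-\int_\Sigma\psi\,d\mu_0\int_\Sigma\varphi\,d\mu_0\right|\le\tau_2^n\,D(\psi,\varphi)\qquad\forall n\ge1,$$ where $D(\psi,\varphi)>0$ is a constant (independent of $n$) depending on the norms of $\psi$ and $\varphi$.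
   Context: $A$ is an aperiodic $N\times N$ matrix with entries in $\{0,1\}$, $\Sigma_A^+=\{\underline x=(x_i)_{i\ge 0}: x_i\in\{1,\dots,N\},\ A_{x_i,x_{i+1}}=1\ \forall i\ge 0\}$, $\theta\in(0,1)$ is fixed, $d_\theta(\underline x,\underline y)=\sum_{i\ge0}\theta^i(1-\delta_{x_i,y_i})$ (Kronecker delta), $\sigma$ is the left shift and $m$ is a fixed $\sigma$-invariant Markov measure on $\Sigma_A^+$. $\mathcal F_\theta(\Sigma_A^+)$ is the space of $d_\theta$-Lipschitz real functions, with $\|\varphi\|_\theta=|\varphi|_\infty+|\varphi|_\theta$ ($|\varphi|_\theta$ the Lipschitz constant). $(K,d)$ is a compact metric space with $\operatorname{diam}K=1$, $\Sigma=\Sigma_A^+\times K$ (product metric $d_\theta+d$), and points $\gamma\in\Sigma_A^+$ are identified with the fibers $\{\gamma\}\times K$. $\mathrm H(\Sigma)$ is the space of real Lipschitz functions on $\Sigma$. $G:\Sigma\to K$ is measurable. (G1) There is $0<\alpha<1$ such that for $m$-a.e. $\underline x$: $d(G(\underline x,y_1),G(\underline x,y_2))\le\alpha\, d(y_1,y_2)$ for all $y_1,y_2\in K$. (G2) For each $y\in K$ there is $k_y\ge0$ with $d(G(\underline x^1,y),G(\underline x^2,y))\le k_y d_\theta(\underline x^1,\underline x^2)$ for all $\underline x^1,\underline x^2$, and $\sup_{y}k_y<\infty$. $\mathcal{AB}_m$ is the set of finite signed Borel measures $\mu$ on $\Sigma$ with $\pi_1^*\mu^\pm\ll m$ (push-forwards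 of the Jordan parts under $\pi_1:\Sigma\to\Sigma_A^+$). For positive $\mu\in\mathcal{AB}_m$ with Rokhlin disintegration $(\{\mu_\gamma\},\phi_1m)$ along the fibers ($\mu_\gamma$ probability measures, $\phi_1=d(\pi_1^*\mu)/dm$), $\mu|_{\gamma}$, for the fiber $\gamma$ over $\underline x$, is the measure on $K$ obtained by pushing $\phi_1(\underline x)\mu_\gamma$ forward under $(\underline x,y)\mapsto y$; for signed $\mu$, $\mu|_\gamma=\mu^+|_\gamma-\mu^-|_\gamma$. For a signed measure $\nu$ on $K$, $\|\nu\|_W=\sup\{|\int g\,d\nu|:\operatorname{Lip}(g)\le1,\|g\|_\infty\le1\}$. $\|\mu\|_\infty=\operatorname{ess\,sup}_{\gamma}\|\mu|_\gamma\|_W$ (w.r.t. $m$), and $S^\infty=\{\mu\in\mathcal{AB}_m:\|\mu\|_\infty<\infty,\ d(\pi_1^*\mu)/dm\in\mathcal F_\theta(\Sigma_A^+)\}$. It is known that under (G1) there is a unique $F$-invariant probability measure $\mu_0\in S^\infty$. *)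

theory Defs
  imports "HOL-Probability.Probability"
begin

section \<open>One-sided subshifts of finite type\<close>

text \<open>
  Symbols are the elements of a finite type \<open>'n\<close> (so \<open>N = CARD('n)\<close>); points of the shift are
  functions \<open>nat \<Rightarrow> 'n\<close>.
\<close>

definition zero_one_matrix :: "nat^'n^'n \<Rightarrow> bool" where
  "zero_one_matrix A \<longleftrightarrow> (\<forall>i j. A $ i $ j \<in> {0, 1})"

definition aperiodic :: "nat^'n^'n \<Rightarrow> bool" where
  "aperiodic A \<longleftrightarrow> (\<exists>k\<ge>1. \<forall>i j. 0 < (((**) A ^^ k) (mat 1)) $ i $ j)"

definition shift_space :: "nat^'n^'n \<Rightarrow> (nat \<Rightarrow> 'n) set" where
  "shift_space A = {x. \<forall>i. A $ x i $ x (Suc i) = 1}"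

definition left_shift :: "(nat \<Rightarrow> 'n) \<Rightarrow> nat \<Rightarrow> 'n" where
  "left_shift x = (\<lambda>i. x (Suc i))"

definition dtheta :: "real \<Rightarrow> (nat \<Rightarrow> 'n) \<Rightarrow> (nat \<Rightarrow> 'n) \<Rightarrow> real" where
  "dtheta \<theta> x y = (\<Sum>i. \<theta> ^ i * (1 - of_bool (x i = y i)))"

text \<open>
  For \<open>0 < \<theta> < 1\<close> the metric \<open>dtheta \<theta>\<close> induces the product topology of the discrete alphabet, so
  its Borel sets are generated by the cylinders, i.e. form the trace of the product
  \<open>\<sigma>\<close>-algebra.  As all factors are separable, the Borel sets of the skew product space form the
  product \<open>\<sigma>\<close>-algebra.
\<close>

definition shift_borel :: "nat^'n^'n \<Rightarrow> (nat \<Rightarrow> 'n) measure" where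
  "shift_borel A = restrict_space (Pi\<^sub>M UNIV (\<lambda>_. count_space UNIV)) (shift_space A)"

definition skew_borel :: "nat^'n^'n \<Rightarrow> ((nat \<Rightarrow> 'n) \<times> 'k::polish_space) measure" where
  "skew_borel A = shift_borel A \<Otimes>\<^sub>M borel"

text \<open>
  The transition matrix of a Markov measure on the subshift is compatible with \<open>A\<close>: the allowed
  transitions are exactly those of positive probability.
\<close>

definition markov_measure :: "nat^'n^'n \<Rightarrow> (nat \<Rightarrow> 'n) measure \<Rightarrow> bool" where
  "markov_measure A m \<longleftrightarrow>
     sets m = sets (shift_borel A) \<and> prob_space m \<and>
     (\<exists>(p::real^'n) (P::real^'n^'n).
        (\<forall>i. 0 \<le> p $ i) \<and> (\<Sum>i\<in>UNIV. p $ i) = 1 \<and>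
        (\<forall>i j. 0 \<le> P $ i $ j) \<and> (\<forall>i. (\<Sum>j\<in>UNIV. P $ i $ j) = 1) \<and>
        (\<forall>i j. 0 < P $ i $ j \<longleftrightarrow> A $ i $ j = 1) \<and>
        (\<forall>w k. measure m {x \<in> shift_space A. \<forall>i\<le>k. x i = w i}
                 = p $ w 0 * (\<Prod>i<k. P $ w i $ w (Suc i))))"


section \<open>Lipschitz functions\<close>

definition lip_bound :: "'a set \<Rightarrow> ('a \<Rightarrow> 'a \<Rightarrow> real) \<Rightarrow> ('a \<Rightarrow> real) \<Rightarrow> real \<Rightarrow> bool" where
  "lip_bound X d f L \<longleftrightarrow> 0 \<le> L \<and> (\<forall>x\<in>X. \<forall>y\<in>X. \<bar>f x - f y\<bar> \<le> L * d x y)"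

definition lip_functions :: "'a set \<Rightarrow> ('a \<Rightarrow> 'a \<Rightarrow> real) \<Rightarrow> ('a \<Rightarrow> real) set" where
  "lip_functions X d = {f. \<exists>L. lip_bound X d f L}"

text \<open>Supremum norm plus the best Lipschitz constant.\<close>

definition lip_norm :: "'a set \<Rightarrow> ('a \<Rightarrow> 'a \<Rightarrow> real) \<Rightarrow> ('a \<Rightarrow> real) \<Rightarrow> real" where
  "lip_norm X d f = (SUP x\<in>X. \<bar>f x\<bar>) + Inf {L. lip_bound X d f L}"

definition F_theta :: "real \<Rightarrow> nat^'n^'n \<Rightarrow> ((nat \<Rightarrow> 'n) \<Rightarrow> real) set" where
  "F_theta \<theta> A = lip_functions (shift_space A) (dtheta \<theta>)"

definition skew_dist :: "real \<Rightarrow> (nat \<Rightarrow> 'n) \<times> 'k::polish_space \<Rightarrow> (nat \<Rightarrow> 'n) \<times> 'k \<Rightarrow> real" where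
  "skew_dist \<theta> u v = dtheta \<theta> (fst u) (fst v) + dist (snd u) (snd v)"

definition H_space :: "real \<Rightarrow> nat^'n^'n \<Rightarrow> ((nat \<Rightarrow> 'n) \<times> 'k::polish_space \<Rightarrow> real) set" where
  "H_space \<theta> A = lip_functions (shift_space A \<times> UNIV) (skew_dist \<theta>)"

definition H_norm :: "real \<Rightarrow> nat^'n^'n \<Rightarrow> ((nat \<Rightarrow> 'n) \<times> 'k::polish_space \<Rightarrow> real) \<Rightarrow> real" where
  "H_norm \<theta> A = lip_norm (shift_space A \<times> UNIV) (skew_dist \<theta>)"


section \<open>Finite signed measures\<close>

text \<open>
  A finite signed measure on \<open>M\<close> is a real-valued set function; its values outside \<open>sets M\<close> are
  irrelevant.  A finite positive measure \<open>\<mu>\<close> becomes the signed measure \<open>measure \<mu>\<close>.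
\<close>

definition signed_measure :: "'a measure \<Rightarrow> ('a set \<Rightarrow> real) \<Rightarrow> bool" where
  "signed_measure M \<nu> \<longleftrightarrow>
     \<nu> {} = 0 \<and>
     (\<forall>E::nat \<Rightarrow> 'a set. range E \<subseteq> sets M \<longrightarrow> disjoint_family E \<longrightarrow>
        (\<lambda>i. \<nu> (E i)) sums \<nu> (\<Union>i. E i))"

text \<open>
  The parts of the Jordan decomposition, \<open>\<nu>\<^sup>+ E = sup {\<nu> B | B \<subseteq> E}\<close> and
  \<open>\<nu>\<^sup>- = (- \<nu>)\<^sup>+\<close>.  The truncation of negative values by \<open>ennreal\<close> is harmless, since
  \<open>B = {}\<close> contributes the value \<open>0\<close>.
\<close>

definition jordan_pos :: "'a measure \<Rightarrow> ('a set \<Rightarrow> real) \<Rightarrow> 'a measure" where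
  "jordan_pos M \<nu> =
     measure_of (space M) (sets M) (\<lambda>E. SUP B\<in>{B \<in> sets M. B \<subseteq> E}. ennreal (\<nu> B))"

definition jordan_neg :: "'a measure \<Rightarrow> ('a set \<Rightarrow> real) \<Rightarrow> 'a measure" where
  "jordan_neg M \<nu> = jordan_pos M (\<lambda>E. - \<nu> E)"

text \<open>\<open>f\<close> is a version of the density \<open>d\<nu>/dm\<close> of a finite signed measure.\<close>

definition signed_density :: "'a measure \<Rightarrow> ('a set \<Rightarrow> real) \<Rightarrow> ('a \<Rightarrow> real) \<Rightarrow> bool" where
  "signed_density m \<nu> f \<longleftrightarrow>
     integrable m f \<and> (\<forall>E\<in>sets m. \<nu> E = (LINT x:E|m. f x))"


section \<open>Disintegration along the fibres and the space \<open>S\<^sup>\<infinity>\<close>\<close>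

definition marginal_density ::
  "(nat \<Rightarrow> 'n) measure \<Rightarrow> ((nat \<Rightarrow> 'n) \<times> 'k::polish_space) measure \<Rightarrow> (nat \<Rightarrow> 'n) \<Rightarrow> ennreal" where
  "marginal_density m \<mu> = RN_deriv m (distr \<mu> m fst)"

definition disintegration ::
  "nat^'n^'n \<Rightarrow> (nat \<Rightarrow> 'n) measure \<Rightarrow> ((nat \<Rightarrow> 'n) \<times> 'k::polish_space) measure \<Rightarrow>
   ((nat \<Rightarrow> 'n) \<Rightarrow> ((nat \<Rightarrow> 'n) \<times> 'k) measure) \<Rightarrow> bool" where
  "disintegration A m \<mu> \<kappa> \<longleftrightarrow>
     \<kappa> \<in> m \<rightarrow>\<^sub>M prob_algebra (skew_borel A) \<and>
     (\<forall>x\<in>shift_space A. emeasure (\<kappa> x) ({x} \<times> UNIV) = 1) \<and>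
     (\<forall>E\<in>sets (skew_borel A).
        emeasure \<mu> E = (\<integral>\<^sup>+x. emeasure (\<kappa> x) E * marginal_density m \<mu> x \<partial>m))"

text \<open>
  \<open>\<mu>|\<^sub>\<gamma>\<close> for positive \<open>\<mu>\<close>.  Disintegrations exist by Rokhlin's theorem and are \<open>\<phi>\<^sub>1 m\<close>-almost
  everywhere unique, so the choice of one is immaterial.
\<close>

definition fibre_restriction ::
  "nat^'n^'n \<Rightarrow> (nat \<Rightarrow> 'n) measure \<Rightarrow> ((nat \<Rightarrow> 'n) \<times> 'k::polish_space) measure \<Rightarrow>
   (nat \<Rightarrow> 'n) \<Rightarrow> 'k measure" where
  "fibre_restriction A m \<mu> x =
     distr (scale_measure (marginal_density m \<mu> x) ((SOME \<kappa>. disintegration A m \<mu> \<kappa>) x)) borel snd"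

text \<open>\<open>\<parallel>\<nu>\<^sub>1 - \<nu>\<^sub>2\<parallel>\<^sub>W\<close> for finite positive \<open>\<nu>\<^sub>1\<close>, \<open>\<nu>\<^sub>2\<close>.\<close>

definition W_norm_diff :: "'k::polish_space measure \<Rightarrow> 'k measure \<Rightarrow> ereal" where
  "W_norm_diff \<nu>1 \<nu>2 =
     (SUP g\<in>{g. 1-lipschitz_on UNIV g \<and> (\<forall>y. \<bar>g y\<bar> \<le> 1)}.
        ereal \<bar>(LINT y|\<nu>1. g y) - (LINT y|\<nu>2. g y)\<bar>)"

definition AB_space ::
  "nat^'n^'n \<Rightarrow> (nat \<Rightarrow> 'n) measure \<Rightarrow> (((nat \<Rightarrow> 'n) \<times> 'k::polish_space) set \<Rightarrow> real) set" where
  "AB_space A m =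
     {\<nu>. signed_measure (skew_borel A) \<nu> \<and>
         absolutely_continuous m (distr (jordan_pos (skew_borel A) \<nu>) m fst) \<and>
         absolutely_continuous m (distr (jordan_neg (skew_borel A) \<nu>) m fst)}"

definition infty_norm ::
  "nat^'n^'n \<Rightarrow> (nat \<Rightarrow> 'n) measure \<Rightarrow> (((nat \<Rightarrow> 'n) \<times> 'k::polish_space) set \<Rightarrow> real) \<Rightarrow> ereal" where
  "infty_norm A m \<nu> =
     esssup m (\<lambda>x. W_norm_diff (fibre_restriction A m (jordan_pos (skew_borel A) \<nu>) x)
                               (fibre_restriction A m (jordan_neg (skew_borel A) \<nu>) x))"

definition S_infty ::
  "real \<Rightarrow> nat^'n^'n \<Rightarrow> (nat \<Rightarrow> 'n) measure \<Rightarrow>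
   (((nat \<Rightarrow> 'n) \<times> 'k::polish_space) set \<Rightarrow> real) set" where
  "S_infty \<theta> A m =
     {\<nu> \<in> AB_space A m. infty_norm A m \<nu> < \<infinity> \<and>
        (\<exists>f\<in>F_theta \<theta> A. signed_density m (\<lambda>E. \<nu> (E \<times> UNIV)) f)}"


section \<open>Skew products\<close>

definition skew :: "((nat \<Rightarrow> 'n) \<times> 'k \<Rightarrow> 'k) \<Rightarrow> (nat \<Rightarrow> 'n) \<times> 'k \<Rightarrow> (nat \<Rightarrow> 'n) \<times> 'k" where
  "skew G = (\<lambda>(x, y). (left_shift x, G (x, y)))"

definition G1 :: "(nat \<Rightarrow> 'n) measure \<Rightarrow> ((nat \<Rightarrow> 'n) \<times> 'k::polish_space \<Rightarrow> 'k) \<Rightarrow> bool" where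
  "G1 m G \<longleftrightarrow>
     (\<exists>\<alpha>. 0 < \<alpha> \<and> \<alpha> < 1 \<and>
        (AE x in m. \<forall>y1 y2. dist (G (x, y1)) (G (x, y2)) \<le> \<alpha> * dist y1 y2))"

definition G2 :: "real \<Rightarrow> nat^'n^'n \<Rightarrow> ((nat \<Rightarrow> 'n) \<times> 'k::polish_space \<Rightarrow> 'k) \<Rightarrow> bool" where
  "G2 \<theta> A G \<longleftrightarrow>
     (\<exists>k::'k \<Rightarrow> real.
        (\<forall>y. 0 \<le> k y \<and>
          (\<forall>x1\<in>shift_space A. \<forall>x2\<in>shift_space A.
             dist (G (x1, y)) (G (x2, y)) \<le> k y * dtheta \<theta> x1 x2)) \<and>
        bdd_above (range k))"

end

theory Submission
  imports Defs
begin

text \<open>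
  Since the matrix is aperiodic, Doeblin's minorization shows that powers of the transition matrix
  converge exponentially fast to the stationary vector, so a function that is nearly constant on
  cylinders of length \<open>k + 1\<close> decorrelates from \<open>h \<circ> \<sigma>\<^sup>k\<^sup>+\<^sup>1\<^sup>+\<^sup>q\<close> at an exponential rate in \<open>q\<close>,
  with only the \<open>L\<^sup>1\<close> norm of \<open>h\<close> entering the bound.  Applied to the Lipschitz density of the marginal
  of \<open>\<mu>\<^sub>0\<close>, which is shift invariant, this shows that the marginal is \<open>m\<close>.  No regularity of the
  disintegration of \<open>\<mu>\<^sub>0\<close> is needed: by invariance,
  \<open>\<integral> (\<psi> \<circ> F\<^sup>n) \<phi> d\<mu>\<^sub>0 = \<integral> (\<psi> \<circ> F\<^sup>2\<^sup>n) (\<phi> \<circ> F\<^sup>n) d\<mu>\<^sub>0\<close>, and by fibre contraction \<open>\<phi> (F\<^sup>n (x, y))\<close> may be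
  replaced by \<open>\<phi> (F\<^sup>n (x, y\<^sub>0))\<close>, a function on the base whose variation on cylinders of length \<open>n + l\<close>
  is of order \<open>\<theta>\<^sup>l\<close>.  The choice \<open>l \<approx> n/2\<close> balances the errors.
\<close>

section \<open>Powers of the transition matrix\<close>

lemma measurable_funpow:
  assumes "T \<in> M \<rightarrow>\<^sub>M M"
  shows "T ^^ n \<in> M \<rightarrow>\<^sub>M M"
  by (induction n) (auto intro: measurable_compose assms)

lemma distr_funpow:
  assumes "T \<in> M \<rightarrow>\<^sub>M M" and "distr M M T = M"
  shows "distr M M (T ^^ n) = M"
proof (induction n)
  case (Suc n)
  have "distr M M (T ^^ Suc n) = distr (distr M M (T ^^ n)) M T"
    using distr_distr[OF assms(1) measurable_funpow[OF assms(1), of n]] by simp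
  then show ?case by (simp only: Suc assms(2))
qed (simp add: distr_id)

section \<open>Averages, and how a guaranteed weight sharpens their bounds\<close>

lemma convex_combination_le:
  fixes v :: "'n::finite \<Rightarrow> real"
  assumes "\<And>i. 0 \<le> w i" and "(\<Sum>i\<in>UNIV. w i) = 1" and "\<And>i. v i \<le> b"
  shows "(\<Sum>i\<in>UNIV. w i * v i) \<le> b"
proof -
  have "(\<Sum>i\<in>UNIV. w i * v i) \<le> (\<Sum>i\<in>UNIV. w i * b)"
    by (intro sum_mono mult_left_mono assms)
  also have "\<dots> = b" using assms(2) by (simp flip: sum_distrib_right)
  finally show ?thesis .
qed

lemma convex_combination_ge:
  fixes v :: "'n::finite \<Rightarrow> real"
  assumes "\<And>i. 0 \<le> w i" and "(\<Sum>i\<in>UNIV. w i) = 1" and "\<And>i. a \<le> v i"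
  shows "a \<le> (\<Sum>i\<in>UNIV. w i * v i)"
  using convex_combination_le[of w "\<lambda>i. - v i" "- a"] assms by (simp add: sum_negf)

text \<open>Doeblin's step. The gaps \<open>b - v i\<close> are nonnegative, so their average is at
  least the contribution of \<open>c\<close> alone. Combined with the lower version, it shrinks an
  interval containing all values by the factor \<open>1 - \<delta>\<close>.\<close>

lemma convex_combination_le_minorized:
  fixes v :: "'n::finite \<Rightarrow> real"
  assumes "\<And>i. 0 \<le> w i" and "(\<Sum>i\<in>UNIV. w i) = 1" and "\<And>i. v i \<le> b" and "\<delta> \<le> w c"
  shows "(\<Sum>i\<in>UNIV. w i * v i) \<le> \<delta> * v c + (1 - \<delta>) * b"
proof -
  have "w c * (b - v c) \<le> (\<Sum>i\<in>UNIV. w i * (b - v i))"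
    by (rule member_le_sum) (auto intro!: mult_nonneg_nonneg assms)
  also have "\<dots> = b - (\<Sum>i\<in>UNIV. w i * v i)"
    using assms(2) by (simp add: right_diff_distrib sum_subtractf flip: sum_distrib_right)
  finally have "(\<Sum>i\<in>UNIV. w i * v i) \<le> b - w c * (b - v c)" by simp
  also have "\<dots> \<le> b - \<delta> * (b - v c)"
    using assms(3)[of c] assms(4) by (intro diff_left_mono mult_right_mono) auto
  finally show ?thesis by (simp add: algebra_simps)
qed

lemma convex_combination_ge_minorized:
  fixes v :: "'n::finite \<Rightarrow> real"
  assumes "\<And>i. 0 \<le> w i" and "(\<Sum>i\<in>UNIV. w i) = 1" and "\<And>i. a \<le> v i" and "\<delta> \<le> w c"
  shows "\<delta> * v c + (1 - \<delta>) * a \<le> (\<Sum>i\<in>UNIV. w i * v i)"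
  using convex_combination_le_minorized[of w "\<lambda>i. - v i" "- a" \<delta> c] assms
  by (simp add: sum_negf algebra_simps)

text \<open>Entries of the \<open>q\<close>-th power of \<open>P\<close>, that is, the
  \<open>q\<close>-step transition probabilities. The recursion conditions on the first
  step.\<close>

primrec kpow :: "real^'n^'n \<Rightarrow> nat \<Rightarrow> 'n \<Rightarrow> 'n \<Rightarrow> real" where
  "kpow P 0 i j = of_bool (i = j)"
| "kpow P (Suc q) i j = (\<Sum>l\<in>UNIV. P $ i $ l * kpow P q l j)"

text \<open>The Chapman-Kolmogorov equation.\<close>

lemma kpow_add: "kpow P (a + b) i j = (\<Sum>l\<in>UNIV. kpow P a i l * kpow P b l j)"
proof (induction a arbitrary: i)
  case 0
  have "(\<Sum>l\<in>UNIV. kpow P 0 i l * kpow P b l j) = (\<Sum>l\<in>{i}. kpow P b l j)"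
    by (intro sum.mono_neutral_cong_right) auto
  then show ?case by simp
next
  case (Suc a)
  show ?case
    by (simp add: Suc sum_distrib_left sum_distrib_right mult.assoc) (rule sum.swap)
qed

section \<open>Stationary Markov measures on the subshift: measurability and iterates of the
  shift\<close>

locale markov_shift = prob_space m
  for A :: "nat^'n^'n" and p :: "real^'n" and P :: "real^'n^'n" and m :: "(nat \<Rightarrow> 'n) measure" +
  assumes zero_one: "zero_one_matrix A"
    and aperiodic: "aperiodic A"
    and sets_eq: "sets m = sets (shift_borel A)"
    and p_sum: "(\<Sum>i\<in>UNIV. p $ i) = 1"
    and p_nonneg: "0 \<le> p $ i"
    and P_nonneg: "0 \<le> P $ i $ j"
    and P_sum: "(\<Sum>j\<in>UNIV. P $ i $ j) = 1"
    and P_pos_iff: "0 < P $ i $ j \<longleftrightarrow> A $ i $ j = 1"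
    and cylinder: "measure m {x \<in> shift_space A. \<forall>i\<le>k. x i = w i}
                     = p $ w 0 * (\<Prod>i<k. P $ w i $ w (Suc i))"
    and invariant: "distr m m left_shift = m"
begin

lemma space_eq: "space m = shift_space A"
proof -
  have "space m = space (shift_borel A)" using sets_eq by (rule sets_eq_imp_space_eq)
  then show ?thesis by (simp add: shift_borel_def space_restrict_space space_PiM)
qed

lemma measurable_coord [measurable]: "(\<lambda>x. x i) \<in> m \<rightarrow>\<^sub>M count_space UNIV"
proof -
  have "(\<lambda>x. x i) \<in> shift_borel A \<rightarrow>\<^sub>M count_space UNIV"
    unfolding shift_borel_def by (intro measurable_restrict_space1 measurable_component_singleton) simp
  then show ?thesis by (simp only: measurable_cong_sets[OF sets_eq refl])
qed

lemma measurable_to_shift: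
  assumes "\<And>i. (\<lambda>x. f x i) \<in> M \<rightarrow>\<^sub>M count_space UNIV" and "\<And>x. x \<in> space M \<Longrightarrow> f x \<in> shift_space A"
  shows "f \<in> M \<rightarrow>\<^sub>M m"
proof -
  have "f \<in> M \<rightarrow>\<^sub>M shift_borel A" unfolding shift_borel_def
  proof (rule measurable_restrict_space2)
    show "f \<in> M \<rightarrow>\<^sub>M Pi\<^sub>M UNIV (\<lambda>_. count_space UNIV)"
      by (rule measurable_PiM_single'[OF assms(1)]) auto
  qed (use assms(2) in auto)
  then show ?thesis by (simp only: measurable_cong_sets[OF refl sets_eq])
qed

lemma left_shift_in: "x \<in> shift_space A \<Longrightarrow> left_shift x \<in> shift_space A"
  by (simp add: shift_space_def left_shift_def)

lemma measurable_left_shift [measurable]: "left_shift \<in> m \<rightarrow>\<^sub>M m"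
proof (rule measurable_to_shift)
  show "(\<lambda>x. left_shift x i) \<in> m \<rightarrow>\<^sub>M count_space UNIV" for i
    unfolding left_shift_def by measurable
qed (simp add: space_eq left_shift_in)

lemma left_shift_funpow: "(left_shift ^^ n) x = (\<lambda>i. x (n + i))"
  by (induction n arbitrary: x) (simp_all add: left_shift_def)

lemma measurable_left_shift_funpow [measurable]: "left_shift ^^ n \<in> m \<rightarrow>\<^sub>M m"
  by (rule measurable_funpow[OF measurable_left_shift])

lemma distr_left_shift_funpow: "distr m m (left_shift ^^ n) = m"
  by (rule distr_funpow[OF measurable_left_shift invariant])

section \<open>Multi-step transition probabilities: stationarity, positivity and convergence\<close>

lemma kpow_nonneg: "0 \<le> kpow P q i j"
  by (induction q arbitrary: i) (auto intro!: sum_nonneg mult_nonneg_nonneg P_nonneg)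

lemma kpow_sum: "(\<Sum>j\<in>UNIV. kpow P q i j) = 1"
proof (induction q arbitrary: i)
  case (Suc q)
  have "(\<Sum>j\<in>UNIV. kpow P (Suc q) i j) = (\<Sum>l\<in>UNIV. P $ i $ l * (\<Sum>j\<in>UNIV. kpow P q l j))"
    by (simp add: sum_distrib_left) (rule sum.swap)
  then show ?case by (simp add: Suc P_sum)
qed simp

lemma kpow_le_1: "kpow P q i j \<le> 1"
  using member_le_sum[of j UNIV "kpow P q i"] kpow_sum[of q i] kpow_nonneg by simp

text \<open>Shift invariance of \<open>m\<close> equates the measures of the events
  \<open>x 0 = j\<close> and \<open>x 1 = j\<close>; splitting the latter by the value of
  \<open>x 0\<close> gives the stationary equation.\<close>

lemma stationary: "(\<Sum>i\<in>UNIV. p $ i * P $ i $ j) = p $ j"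
proof -
  have *: "measure m {x \<in> space m. x 0 = i \<and> x 1 = j} = p $ i * P $ i $ j" for i
  proof -
    have "{x \<in> space m. x 0 = i \<and> x 1 = j} = {x \<in> shift_space A. \<forall>k\<le>1. x k = (if k = 0 then i else j)}"
      unfolding space_eq by (auto simp: le_Suc_eq)
    then show ?thesis using cylinder[of 1 "\<lambda>k. if k = 0 then i else j"] by simp
  qed
  have "p $ j = measure m {x \<in> space m. x 0 = j}"
    using cylinder[of 0 "\<lambda>_. j"] by (simp add: space_eq)
  also have "\<dots> = measure (distr m m left_shift) {x \<in> space m. x 0 = j}" by (simp add: invariant)
  also have "\<dots> = measure m {x \<in> space m. x 1 = j}"
  proof (subst measure_distr)
    have "left_shift -` {x \<in> space m. x 0 = j} \<inter> space m = {x \<in> space m. x 1 = j}"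
      unfolding space_eq by (auto simp: left_shift_in) (auto simp: left_shift_def)
    then show "measure m (left_shift -` {x \<in> space m. x 0 = j} \<inter> space m)
        = measure m {x \<in> space m. x 1 = j}" by (rule arg_cong)
  qed measurable
  also have "{x \<in> space m. x 1 = j} = (\<Union>i\<in>UNIV. {x \<in> space m. x 0 = i \<and> x 1 = j})" by auto
  also have "measure m \<dots> = (\<Sum>i\<in>UNIV. measure m {x \<in> space m. x 0 = i \<and> x 1 = j})"
    by (rule finite_measure_finite_Union) (auto simp: disjoint_family_on_def)
  finally show ?thesis unfolding * ..
qed

lemma stationary_kpow: "(\<Sum>i\<in>UNIV. p $ i * kpow P q i j) = p $ j"
proof (induction q)
  case 0
  have "(\<Sum>i\<in>UNIV. p $ i * kpow P 0 i j) = (\<Sum>i\<in>{j}. p $ i)"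
    by (intro sum.mono_neutral_cong_right) auto
  then show ?case by simp
next
  case (Suc q)
  have "(\<Sum>i\<in>UNIV. p $ i * kpow P (Suc q) i j)
      = (\<Sum>l\<in>UNIV. (\<Sum>i\<in>UNIV. p $ i * P $ i $ l) * kpow P q l j)"
    by (simp add: sum_distrib_left sum_distrib_right mult.assoc) (rule sum.swap)
  then show ?case by (simp add: Suc stationary)
qed

text \<open>The entries of the power of \<open>A\<close> are natural numbers, so a positive sum has
  a positive summand; its first factor must be 1, and \<open>P_pos_iff\<close> turns this into a
  positive transition probability.\<close>

lemma kpow_pos: "0 < (((**) A ^^ k) (mat 1)) $ i $ j \<Longrightarrow> 0 < kpow P k i j"
proof (induction k arbitrary: i)
  case 0
  then show ?case by (simp add: mat_def split: if_splits)
next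
  case (Suc k)
  let ?X = "((**) A ^^ k) (mat 1)"
  have "(\<Sum>l\<in>UNIV. A $ i $ l * ?X $ l $ j) > 0"
    using Suc.prems by (simp only: funpow.simps(2) comp_def) (simp only: matrix_matrix_mult_def[of A ?X] vec_lambda_beta)
  then obtain l where l: "A $ i $ l * ?X $ l $ j > 0"
    by (metis (no_types, lifting) gr0I less_irrefl sum.neutral)
  have "A $ i $ l \<in> {0, 1}" using zero_one by (simp add: zero_one_matrix_def)
  with l have "A $ i $ l = 1" by auto
  then have "0 < P $ i $ l * kpow P k l j" using Suc.IH l P_pos_iff by simp
  also have "\<dots> \<le> (\<Sum>l\<in>UNIV. P $ i $ l * kpow P k l j)"
    by (rule member_le_sum) (auto intro!: mult_nonneg_nonneg P_nonneg kpow_nonneg)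
  finally show ?case by simp
qed

lemma minorization:
  obtains k \<delta> where "k \<ge> 1" "0 < \<delta>" "\<delta> < 1" "\<And>i j. \<delta> \<le> kpow P k i j"
proof -
  obtain k where k: "k \<ge> 1" "\<And>i j. 0 < kpow P k i j"
    using aperiodic kpow_pos unfolding aperiodic_def by blast
  \<comment> \<open>Including 1/2 forces \<open>\<delta> < 1\<close> even when every entry of the
    power equals 1, as happens for a one-letter alphabet.\<close>
  define S where "S = insert (1/2) (range (\<lambda>(i, j). kpow P k i j))"
  have "finite S" by (simp add: S_def)
  then have "Min S \<in> S" by (rule Min_in) (simp add: S_def)
  then have "0 < Min S" using k by (auto simp: S_def)
  moreover have "Min S \<le> s" if "s \<in> S" for s using \<open>finite S\<close> that by simp
  ultimately have "Min S \<le> 1/2" "\<And>i j. Min S \<le> kpow P k i j"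
    unfolding S_def by (blast, metis (mono_tags, lifting) insertI2 rangeI case_prod_conv)
  then show ?thesis
    using that[OF k(1), of "Min S"] \<open>0 < Min S\<close> by simp
qed

text \<open>By stationarity \<open>p $ j\<close> is an average of column \<open>j\<close> of a power
  whose entries are all at least \<open>\<delta>\<close>.\<close>

lemma p_pos: "0 < p $ j"
proof -
  obtain k \<delta> where "0 < \<delta>" "\<And>i j. \<delta> \<le> kpow P k i j" using minorization by metis
  then have "\<delta> \<le> (\<Sum>i\<in>UNIV. p $ i * kpow P k i j)"
    by (intro convex_combination_ge p_nonneg p_sum)
  with \<open>0 < \<delta>\<close> show ?thesis by (simp only: stationary_kpow)
qed

text \<open>Each block of \<open>k\<close> steps shrinks the interval containing a column by the
  factor \<open>1 - \<delta>\<close>, and \<open>p $ j\<close>, being an average of that column,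
  stays inside it. The error is stated relative to \<open>p $ j\<close> because the quotient appears
  later as a density with respect to \<open>m\<close>.\<close>

lemma kpow_convergence:
  obtains C \<rho> where "0 \<le> C" "0 < \<rho>" "\<rho> < 1" "\<And>q i j. \<bar>kpow P q i j / p $ j - 1\<bar> \<le> C * \<rho> ^ q"
proof -
  obtain k \<delta> where k: "k \<ge> 1" "0 < \<delta>" "\<delta> < 1" "\<And>i j. \<delta> \<le> kpow P k i j" using minorization by metis
  have osc: "\<exists>a b. (\<forall>i. a \<le> kpow P (k * t + s) i j \<and> kpow P (k * t + s) i j \<le> b) \<and> b - a \<le> (1 - \<delta>) ^ t"
    for t s j
  proof (induction t)
    case 0
    show ?case using kpow_nonneg kpow_le_1 by (intro exI[of _ 0] exI[of _ 1]) simp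
  next
    case (Suc t)
    then obtain a b where ab: "\<And>i. a \<le> kpow P (k * t + s) i j" "\<And>i. kpow P (k * t + s) i j \<le> b"
      "b - a \<le> (1 - \<delta>) ^ t" by blast
    \<comment> \<open>The minorized weight is put on one fixed state, here \<open>j\<close>, for all
      rows \<open>i\<close>. Upper and lower bound then share the summand \<open>c\<close>, which
      cancels in the length of the new interval.\<close>
    define c where "c = \<delta> * kpow P (k * t + s) j j"
    have eq: "kpow P (k * Suc t + s) i j = (\<Sum>l\<in>UNIV. kpow P k i l * kpow P (k * t + s) l j)" for i
      using kpow_add[of P k "k * t + s" i j] by (simp add: add.assoc)
    have "c + (1 - \<delta>) * a \<le> kpow P (k * Suc t + s) i j" for i
      unfolding eq c_def by (rule convex_combination_ge_minorized) (auto simp: kpow_nonneg kpow_sum ab k)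
    moreover have "kpow P (k * Suc t + s) i j \<le> c + (1 - \<delta>) * b" for i
      unfolding eq c_def by (rule convex_combination_le_minorized) (auto simp: kpow_nonneg kpow_sum ab k)
    moreover have "(c + (1 - \<delta>) * b) - (c + (1 - \<delta>) * a) \<le> (1 - \<delta>) ^ Suc t"
      using mult_left_mono[OF ab(3), of "1 - \<delta>"] k by (simp add: algebra_simps)
    ultimately show ?case by blast
  qed
  have conv: "\<bar>kpow P q i j - p $ j\<bar> \<le> (1 - \<delta>) ^ (q div k)" for q i j
  proof -
    obtain a b where ab: "\<And>i. a \<le> kpow P q i j" "\<And>i. kpow P q i j \<le> b" "b - a \<le> (1 - \<delta>) ^ (q div k)"
      using osc[of "q div k" "q mod k" j] by auto
    have "a \<le> p $ j" "p $ j \<le> b"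
      using convex_combination_ge[of "\<lambda>i. p $ i" a "\<lambda>i. kpow P q i j"]
        convex_combination_le[of "\<lambda>i. p $ i" "\<lambda>i. kpow P q i j" b] ab
      by (simp_all add: p_nonneg p_sum stationary_kpow)
    then show ?thesis using ab(1)[of i] ab(2)[of i] ab(3) by linarith
  qed
  \<comment> \<open>The rate per step is the \<open>k\<close>-th root of the rate per block.
    Rounding in \<open>q div k\<close> loses at most one block, hence the division by
    \<open>1 - \<delta>\<close> below.\<close>
  define \<rho> where "\<rho> = root k (1 - \<delta>)"
  have \<rho>: "0 < \<rho>" "\<rho> < 1" "\<rho> ^ k = 1 - \<delta>" using k by (simp_all add: \<rho>_def)
  have pow: "(1 - \<delta>) ^ (q div k) \<le> \<rho> ^ q / (1 - \<delta>)" for q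
  proof -
    have "q \<le> k * (q div k) + k"
      using k(1) by (metis add_left_mono le_trans less_imp_le mod_less_divisor mult_div_mod_eq zero_less_one order_less_le_trans)
    then have "\<rho> ^ (k * (q div k) + k) \<le> \<rho> ^ q" using \<rho> by (intro power_decreasing) auto
    then show ?thesis using k \<rho> by (simp add: power_add power_mult field_simps)
  qed
  \<comment> \<open>The least entry of \<open>p\<close> makes the relative bound uniform in
    \<open>j\<close>.\<close>
  define p0 where "p0 = Min (range (($) p))"
  have "p0 \<in> range (($) p)" unfolding p0_def by (rule Min_in) auto
  then have p0: "0 < p0" "\<And>j. p0 \<le> p $ j" using p_pos by (auto simp: p0_def)
  show ?thesis
  proof (rule that[of "1 / (p0 * (1 - \<delta>))" \<rho>])
    fix q i j
    have "\<bar>kpow P q i j / p $ j - 1\<bar> = \<bar>kpow P q i j - p $ j\<bar> / p $ j"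
      using p_pos[of j] by (simp add: field_simps abs_if)
    also have "\<dots> \<le> (\<rho> ^ q / (1 - \<delta>)) / p0"
      using conv[of q i j] pow[of q] p0 by (intro frac_le) auto
    finally show "\<bar>kpow P q i j / p $ j - 1\<bar> \<le> 1 / (p0 * (1 - \<delta>)) * \<rho> ^ q" by (simp add: mult.commute)
  qed (use k \<rho> p0 in auto)
qed

end

section \<open>Mixing of cylinders\<close>

context markov_shift
begin

text \<open>Depth \<open>k\<close> fixes \<open>k + 1\<close> coordinates, which explains the shifts
  by \<open>k + 1 + q\<close> below. The word is given as a full sequence, of which only an initial
  segment matters.\<close>

definition cyl :: "nat \<Rightarrow> (nat \<Rightarrow> 'n) \<Rightarrow> (nat \<Rightarrow> 'n) set" where
  "cyl k w = {x \<in> space m. \<forall>i\<le>k. x i = w i}"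

lemma sets_cyl [measurable]: "cyl k w \<in> sets m"
  unfolding cyl_def by measurable

lemma measure_cyl: "measure m (cyl k w) = p $ w 0 * (\<Prod>i<k. P $ w i $ w (Suc i))"
  unfolding cyl_def space_eq by (rule cylinder)

lemma cyl_Int: "cyl k w \<inter> cyl l u = {} \<or> (\<exists>j v. cyl k w \<inter> cyl l u = cyl j v)"
proof (cases "\<forall>i\<le>min k l. w i = u i")
  case True
  then have "cyl k w \<inter> cyl l u = cyl (max k l) (if k \<le> l then u else w)"
    by (auto simp: cyl_def max_def min_def split: if_splits)
  then show ?thesis by blast
next
  case False
  then have "cyl k w \<inter> cyl l u = {}" by (auto simp: cyl_def)
  then show ?thesis by blast
qed

text \<open>The Markov property across a gap. With \<open>q\<close> free coordinates between the two
  words there are \<open>q + 1\<close> transitions, hence the exponent \<open>Suc q\<close>. The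
  induction fills the first free coordinate, which lengthens the left word and shortens the
  gap.\<close>

lemma measure_cyl_gap:
  "measure m {x \<in> space m. (\<forall>i\<le>k. x i = w i) \<and> (\<forall>i\<le>r. x (k + 1 + q + i) = u i)}
     = measure m (cyl k w) * kpow P (Suc q) (w k) (u 0) * (\<Prod>i<r. P $ u i $ u (Suc i))"
proof (induction q arbitrary: k w)
  case 0
  \<comment> \<open>Without a gap the two words concatenate to a single cylinder.\<close>
  define v where "v i = (if i \<le> k then w i else u (i - (k + 1)))" for i
  have eq: "{x \<in> space m. (\<forall>i\<le>k. x i = w i) \<and> (\<forall>i\<le>r. x (k + 1 + 0 + i) = u i)} = cyl (k + 1 + r) v"
  proof -
    have "(\<forall>i\<le>k. x i = w i) \<and> (\<forall>i\<le>r. x (k + 1 + 0 + i) = u i) \<longleftrightarrow> (\<forall>i\<le>k + 1 + r. x i = v i)"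
      (is "?l \<longleftrightarrow> ?r") for x
    proof
      assume l: ?l
      show ?r
      proof (intro allI impI)
        fix i assume i: "i \<le> k + 1 + r"
        show "x i = v i"
        proof (cases "i \<le> k")
          case False
          then have "i = k + 1 + 0 + (i - (k + 1))" "i - (k + 1) \<le> r" using i by auto
          then have "x i = u (i - (k + 1))" using l by metis
          then show ?thesis using False by (simp add: v_def)
        qed (use l in \<open>simp add: v_def\<close>)
      qed
    next
      assume r: ?r
      have "x i = w i" if "i \<le> k" for i
        using r[rule_format, of i] that by (simp add: v_def)
      moreover have "x (k + 1 + 0 + i) = u i" if "i \<le> r" for i
        using r[rule_format, of "k + 1 + i"] that by (simp add: v_def)
      ultimately show ?l by blast
    qed
    then show ?thesis by (auto simp: cyl_def)
  qed
  have split: "(\<Prod>i<k + 1 + r. f i) = (\<Prod>i<k. f i) * f k * (\<Prod>i<r. f (k + 1 + i))" for f :: "nat \<Rightarrow> real"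
    by (induction r) (simp_all add: mult.assoc)
  have k: "kpow P (Suc 0) (w k) (u 0) = P $ w k $ u 0"
  proof -
    have "(\<Sum>l\<in>UNIV. P $ w k $ l * of_bool (l = u 0)) = (\<Sum>l\<in>{u 0}. P $ w k $ l)"
      by (intro sum.mono_neutral_cong_right) auto
    then show ?thesis by simp
  qed
  show ?case unfolding eq measure_cyl split k by (simp add: v_def)
next
  case (Suc q)
  let ?w = "\<lambda>j. w(Suc k := j)"
  let ?E = "\<lambda>j. {x \<in> space m. (\<forall>i\<le>Suc k. x i = ?w j i) \<and> (\<forall>i\<le>r. x (Suc k + 1 + q + i) = u i)}"
  have "{x \<in> space m. (\<forall>i\<le>k. x i = w i) \<and> (\<forall>i\<le>r. x (k + 1 + Suc q + i) = u i)} = (\<Union>j. ?E j)"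
    by (auto simp: le_Suc_eq)
  moreover have "measure m (\<Union>j. ?E j) = (\<Sum>j\<in>UNIV. measure m (?E j))"
    by (rule finite_measure_finite_Union) (auto simp: disjoint_family_on_def)
  moreover have "measure m (?E j) = measure m (cyl k w) * P $ w k $ j * kpow P (Suc q) j (u 0)
      * (\<Prod>i<r. P $ u i $ u (Suc i))" for j
  proof -
    have "measure m (cyl (Suc k) (?w j)) = measure m (cyl k w) * P $ w k $ j"
      by (simp add: measure_cyl)
    then show ?thesis by (subst Suc.IH) simp
  qed
  ultimately show ?case
    by (simp add: sum_distrib_left sum_distrib_right mult.assoc del: kpow.simps)
       (simp add: sum_distrib_left sum_distrib_right mult.assoc)
qed

text \<open>For the nontrivial inclusion, the identity is measurable from the cylinder-generated
  space to \<open>m\<close>, since the preimage of a letter under a coordinate is a finite union of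
  cylinders.\<close>

lemma sets_eq_sigma_cyl: "sets m = sigma_sets (space m) (range (\<lambda>(k, w). cyl k w))"
proof
  let ?C = "range (\<lambda>(k, w). cyl k w)"
  have C: "?C \<subseteq> Pow (space m)" by (auto simp: cyl_def)
  show "sigma_sets (space m) ?C \<subseteq> sets m"
    by (rule sets.sigma_sets_subset) auto
  let ?S = "sigma (space m) ?C"
  have id: "(\<lambda>x. x) \<in> ?S \<rightarrow>\<^sub>M m"
  proof (rule measurable_to_shift)
    show "(\<lambda>x. x i) \<in> ?S \<rightarrow>\<^sub>M count_space UNIV" for i
    unfolding measurable_count_space_eq2[OF finite_class.finite_UNIV] proof (intro conjI ballI)
      fix a :: 'n
      let ?W = "{w \<in> PiE {..i} (\<lambda>_. UNIV). w i = a}"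
      have "(\<lambda>x. x i) -` {a} \<inter> space ?S = (\<Union>w\<in>?W. cyl i w)"
      proof (intro set_eqI iffI)
        fix x assume x: "x \<in> (\<lambda>x. x i) -` {a} \<inter> space ?S"
        then have "restrict x {..i} \<in> ?W" "x \<in> cyl i (restrict x {..i})"
          using C by (auto simp: cyl_def)
        then show "x \<in> (\<Union>w\<in>?W. cyl i w)" by blast
      qed (use C in \<open>auto simp: cyl_def\<close>)
      moreover have "cyl i w \<in> sets ?S" for w
        using C by (auto intro!: sigma_sets.Basic)
      moreover have "finite ?W" by (rule finite_subset[of _ "PiE {..i} (\<lambda>_. UNIV)"]) (auto intro!: finite_PiE)
      ultimately show "(\<lambda>x. x i) -` {a} \<inter> space ?S \<in> sets ?S" by auto
    qed auto
    show "x \<in> space ?S \<Longrightarrow> x \<in> shift_space A" for x using C by (simp add: space_eq)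
  qed
  show "sets m \<subseteq> sigma_sets (space m) ?C"
  proof
    fix E assume E: "E \<in> sets m"
    have "(\<lambda>x. x) -` E \<inter> space ?S \<in> sets ?S" using id E by (rule measurable_sets)
    then show "E \<in> sigma_sets (space m) ?C" using C sets.sets_into_space[OF E] by (simp add: Int_absorb2)
  qed
qed

text \<open>The density is the transfer operator, iterated \<open>k + 1 + q\<close> times, applied
  to the indicator of a cylinder. It depends on coordinate 0 only, by the Markov property. Both
  measures agree on cylinders, which together with the empty set form an intersection-stable
  generator.\<close>

lemma distr_cylinder_shift:
  "distr (density m (indicator (cyl k w))) m (left_shift ^^ (k + 1 + q))
     = density m (\<lambda>x. ennreal (measure m (cyl k w) * (kpow P (Suc q) (w k) (x 0) / p $ x 0)))"
  (is "?L = density m ?c")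
proof (rule measure_eqI_generator_eq_countable)
  let ?C = "insert {} (range (\<lambda>(k, w). cyl k w))"
  \<comment> \<open>Depth-zero cylinders provide the countable cover by sets of finite measure that
    the uniqueness theorem requires.\<close>
  let ?U = "range (\<lambda>a. cyl 0 (\<lambda>_. a))"
  show "Int_stable ?C"
    using cyl_Int by (fastforce simp: Int_stable_def)
  show "?C \<subseteq> Pow (space m)" by (auto simp: cyl_def)
  have "sigma_sets (space m) ?C = sigma_sets (space m) (range (\<lambda>(k, w). cyl k w))"
    by (rule sigma_sets_eqI) (auto intro: sigma_sets.Empty sigma_sets.Basic)
  then show "sets ?L = sigma_sets (space m) ?C" "sets (density m ?c) = sigma_sets (space m) ?C"
    by (simp_all flip: sets_eq_sigma_cyl)
  show "?U \<subseteq> ?C" by auto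
  show "countable ?U" by (simp add: countable_finite)
  show "\<Union> ?U = space m" by (auto simp: cyl_def)
  have c [measurable]: "?c \<in> borel_measurable m"
    by (rule measurable_compose[OF measurable_coord[of 0]]) simp
  have L: "emeasure ?L E = ennreal (measure m (cyl k w \<inter> ((left_shift ^^ (k + 1 + q)) -` E \<inter> space m)))"
    if [measurable]: "E \<in> sets m" for E
  proof -
    have "emeasure ?L E = emeasure (density m (indicator (cyl k w))) ((left_shift ^^ (k + 1 + q)) -` E \<inter> space m)"
      by (subst emeasure_distr) (auto simp del: funpow.simps)
    also have "\<dots> = emeasure m (cyl k w \<inter> ((left_shift ^^ (k + 1 + q)) -` E \<inter> space m))"
      by (subst emeasure_density)
         (auto simp del: funpow.simps simp: nn_integral_set_ennreal[symmetric] simp flip: indicator_inter_arith)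
    finally show ?thesis by (simp add: emeasure_eq_measure)
  qed
  show "emeasure ?L E \<noteq> \<infinity>" if "E \<in> ?U" for E
    using that by (subst L) auto
  show "emeasure ?L E = emeasure (density m ?c) E" if E: "E \<in> ?C" for E
  proof (cases "E = {}")
    case False
    then obtain r u where E: "E = cyl r u" using E by auto
    have "cyl k w \<inter> ((left_shift ^^ (k + 1 + q)) -` E \<inter> space m)
        = {x \<in> space m. (\<forall>i\<le>k. x i = w i) \<and> (\<forall>i\<le>r. x (k + 1 + q + i) = u i)}"
      using measurable_space[OF measurable_left_shift_funpow[of "k + 1 + q"]]
      unfolding E cyl_def by (auto simp: left_shift_funpow simp del: funpow.simps)
    then have "emeasure ?L E = ennreal (measure m (cyl k w) * kpow P (Suc q) (w k) (u 0) * (\<Prod>i<r. P $ u i $ u (Suc i)))"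
      unfolding L[OF sets_cyl[of r u, folded E]] by (simp only: measure_cyl_gap)
    \<comment> \<open>Multiplying and dividing by \<open>p $ u 0\<close>, which is positive,
      completes the product to the measure of \<open>cyl r u\<close>.\<close>
    also have "\<dots> = ennreal (measure m (cyl k w) * (kpow P (Suc q) (w k) (u 0) / p $ u 0)) * ennreal (measure m E)"
      using p_pos[of "u 0"] kpow_nonneg[of "Suc q" "w k" "u 0"] unfolding E measure_cyl[of r u]
      by (simp add: ennreal_mult[symmetric] prod_nonneg P_nonneg less_imp_le del: kpow.simps)
    also have "\<dots> = (\<integral>\<^sup>+x. ennreal (measure m (cyl k w) * (kpow P (Suc q) (w k) (u 0) / p $ u 0)) * indicator E x \<partial>m)"
      unfolding E by (simp add: nn_integral_cmult emeasure_eq_measure)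
    \<comment> \<open>On \<open>E\<close> coordinate 0 equals \<open>u 0\<close>, so the constant
      agrees with the density there.\<close>
    also have "\<dots> = (\<integral>\<^sup>+x. ?c x * indicator E x \<partial>m)"
      unfolding E by (rule nn_integral_cong) (simp add: cyl_def indicator_def del: kpow.simps)
    also have "\<dots> = emeasure (density m ?c) E"
      unfolding E by (simp add: emeasure_density)
    finally show ?thesis .
  qed simp
qed

lemma integral_cylinder_shift:
  assumes [measurable]: "h \<in> borel_measurable m"
  shows "(LINT x|m. indicator (cyl k w) x * h ((left_shift ^^ (k + 1 + q)) x))
    = measure m (cyl k w) * (LINT x|m. kpow P (Suc q) (w k) (x 0) / p $ x 0 * h x)" (is "?l = _")
proof -
  have [measurable]: "(\<lambda>x. measure m (cyl k w) * (kpow P (Suc q) (w k) (x 0) / p $ x 0)) \<in> borel_measurable m"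
    by (rule measurable_compose[OF measurable_coord[of 0]]) simp
  have "?l = (LINT x|density m (indicator (cyl k w)). h ((left_shift ^^ (k + 1 + q)) x))"
    using integral_density[of "\<lambda>x. h ((left_shift ^^ (k + 1 + q)) x)" m "indicator (cyl k w)"]
    by (simp del: funpow.simps add: ennreal_indicator)
  also have "\<dots> = (LINT x|distr (density m (indicator (cyl k w))) m (left_shift ^^ (k + 1 + q)). h x)"
    by (subst integral_distr) (auto simp del: funpow.simps)
  also have "\<dots> = (LINT x|m. measure m (cyl k w) * (kpow P (Suc q) (w k) (x 0) / p $ x 0) * h x)"
    unfolding distr_cylinder_shift
    by (subst integral_density) (auto simp del: kpow.simps intro!: divide_nonneg_nonneg mult_nonneg_nonneg p_nonneg kpow_nonneg)
  finally show ?thesis by (simp only: mult.assoc integral_mult_right_zero)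
qed

end

section \<open>Decay of correlations on the shift\<close>

lemma summable_dtheta:
  assumes "0 < \<theta>" and "\<theta> < 1"
  shows "summable (\<lambda>i. \<theta> ^ i * (1 - of_bool (x i = y i)) :: real)"
  using assms by (intro summable_comparison_test[OF _ summable_geometric[of \<theta>]]) (auto simp: abs_mult)

lemma dtheta_nonneg: "0 < \<theta> \<Longrightarrow> \<theta> < 1 \<Longrightarrow> 0 \<le> dtheta \<theta> x y"
  unfolding dtheta_def by (intro suminf_nonneg summable_dtheta) auto

text \<open>Agreement removes the first \<open>n\<close> terms; the rest is dominated by a geometric
  tail.\<close>

lemma dtheta_le:
  assumes \<theta>: "0 < \<theta>" "\<theta> < 1" and eq: "\<And>i. i < n \<Longrightarrow> x i = y i"
  shows "dtheta \<theta> x y \<le> \<theta> ^ n / (1 - \<theta>)"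
proof -
  let ?f = "\<lambda>i. \<theta> ^ i * (1 - of_bool (x i = y i)) :: real"
  have "dtheta \<theta> x y = (\<Sum>i. ?f (i + n)) + (\<Sum>i<n. ?f i)"
    unfolding dtheta_def by (rule suminf_split_initial_segment[OF summable_dtheta[OF \<theta>]])
  also have "(\<Sum>i<n. ?f i) = 0" using eq by simp
  also have "(\<Sum>i. ?f (i + n)) \<le> (\<Sum>i. \<theta> ^ n * \<theta> ^ i)"
    using \<theta> by (intro suminf_le summable_ignore_initial_segment[OF summable_dtheta] summable_mult summable_geometric)
      (auto simp: power_add)
  also have "\<dots> = \<theta> ^ n / (1 - \<theta>)"
    using \<theta> by (subst suminf_mult) (auto simp: suminf_geometric)
  finally show ?thesis by simp
qed

section \<open>Integrals of products with a bounded factor\<close>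

lemma integrable_mult_bounded:
  fixes h g :: "'a \<Rightarrow> real"
  assumes "integrable M h" and [measurable]: "g \<in> borel_measurable M" and "AE x in M. \<bar>g x\<bar> \<le> B"
  shows "integrable M (\<lambda>x. h x * g x)"
proof (rule Bochner_Integration.integrable_bound)
  show "integrable M (\<lambda>x. h x * B)" using assms(1) by simp
  show "(\<lambda>x. h x * g x) \<in> borel_measurable M" using assms(1) by measurable
  show "AE x in M. norm (h x * g x) \<le> norm (h x * B)"
    using assms(3) by eventually_elim (auto simp: abs_mult intro!: mult_left_mono)
qed

text \<open>The bound \<open>B\<close> serves only to make both products integrable; the estimate
  itself involves the distance of the factors and the L^1 norm of \<open>h\<close>.\<close>

lemma integral_mult_diff_le:
  fixes h g1 g2 :: "'a \<Rightarrow> real"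
  assumes h: "integrable M h" and "g1 \<in> borel_measurable M" and "g2 \<in> borel_measurable M"
    and "AE x in M. \<bar>g1 x\<bar> \<le> B" and "AE x in M. \<bar>g2 x\<bar> \<le> B"
    and d: "AE x in M. \<bar>g1 x - g2 x\<bar> \<le> \<delta>"
  shows "\<bar>(LINT x|M. h x * g1 x) - (LINT x|M. h x * g2 x)\<bar> \<le> \<delta> * (LINT x|M. \<bar>h x\<bar>)"
proof -
  note i = integrable_mult_bounded[OF h assms(2,4)] integrable_mult_bounded[OF h assms(3,5)]
  have "(LINT x|M. h x * g1 x) - (LINT x|M. h x * g2 x) = (LINT x|M. h x * g1 x - h x * g2 x)"
    by (rule Bochner_Integration.integral_diff[OF i, symmetric])
  also have "\<bar>\<dots>\<bar> \<le> (LINT x|M. \<bar>h x * g1 x - h x * g2 x\<bar>)" by (rule integral_abs_bound)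
  also have "\<dots> \<le> (LINT x|M. \<delta> * \<bar>h x\<bar>)"
  proof (rule integral_mono_AE)
    show "AE x in M. \<bar>h x * g1 x - h x * g2 x\<bar> \<le> \<delta> * \<bar>h x\<bar>"
      using d by eventually_elim (auto simp: abs_mult mult.commute[of \<delta>] intro!: mult_left_mono simp flip: right_diff_distrib)
  qed (use i h in auto)
  finally show ?thesis by simp
qed

context markov_shift
begin

section \<open>Cylinder expansions and mixing against nearly cylindrical functions\<close>

lemma integral_shift:
  assumes [measurable]: "h \<in> borel_measurable m"
  shows "(LINT x|m. h ((left_shift ^^ n) x)) = (LINT x|m. h x :: real)"
  using integral_distr[OF measurable_left_shift_funpow assms, of n] by (simp add: distr_left_shift_funpow)

lemma integrable_shift:
  fixes h :: "_ \<Rightarrow> real"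
  assumes "integrable m h"
  shows "integrable m (\<lambda>x. h ((left_shift ^^ n) x))"
  by (rule integrable_distr[OF measurable_left_shift_funpow]) (simp add: distr_left_shift_funpow assms)

lemma sum_measure_cyl: "(\<Sum>w\<in>PiE {..k} (\<lambda>_. UNIV). measure m (cyl k w)) = 1"
proof -
  let ?W = "PiE {..k} (\<lambda>_. UNIV :: 'n set)"
  have "x \<in> (\<Union>w\<in>?W. cyl k w)" if "x \<in> space m" for x
    using that by (intro UN_I[of "restrict x {..k}"]) (auto simp: cyl_def)
  then have "space m = (\<Union>w\<in>?W. cyl k w)" by (auto simp: cyl_def)
  moreover have "disjoint_family_on (cyl k) ?W"
    unfolding disjoint_family_on_def by (auto simp: cyl_def) (metis PiE_ext atMost_iff)
  then have "measure m (\<Union>w\<in>?W. cyl k w) = (\<Sum>w\<in>?W. measure m (cyl k w))"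
    by (intro finite_measure_finite_Union) (auto intro!: finite_PiE)
  ultimately show ?thesis using prob_space by simp
qed

text \<open>Exactly one word of length \<open>k + 1\<close> matches \<open>x\<close>, namely its
  prefix. Functions of the prefix thus become finite combinations of cylinder indicators.\<close>

lemma sum_indicator_cyl:
  fixes G :: "_ \<Rightarrow> real"
  assumes "x \<in> space m"
  shows "(\<Sum>w\<in>PiE {..k} (\<lambda>_. UNIV). G w * indicator (cyl k w) x) = G (restrict x {..k})"
proof -
  let ?W = "PiE {..k} (\<lambda>_. UNIV :: 'n set)"
  have "finite ?W" by (auto intro!: finite_PiE)
  have "w = restrict x {..k}" if "w \<in> ?W" "x \<in> cyl k w" for w
    using that by (intro PiE_ext[of w "{..k}" "\<lambda>_. UNIV"]) (auto simp: cyl_def)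
  then have *: "\<forall>w\<in>?W - {restrict x {..k}}. G w * indicator (cyl k w) x = 0"
    by (auto simp: indicator_def)
  have "(\<Sum>w\<in>?W. G w * indicator (cyl k w) x) = (\<Sum>w\<in>{restrict x {..k}}. G w)"
    by (rule sum.mono_neutral_cong_right[OF \<open>finite ?W\<close> _ *]) (use assms in \<open>auto simp: cyl_def\<close>)
  then show ?thesis by simp
qed

text \<open>Replacing \<open>g\<close> by a function constant on cylinders of depth \<open>k\<close>
  costs \<open>\<delta>\<close> in each of the two terms. For that function, each cylinder tests
  \<open>h\<close> against a density within \<open>C * \<rho> ^ q\<close> of 1. The oscillation
  condition is asymmetric, almost every \<open>x\<close> against every \<open>x'\<close>, because
  \<open>x'\<close> will be a sample point over which there is no control.\<close>

lemma decay_of_correlations: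
  obtains C \<rho> where "0 \<le> C" "0 < \<rho>" "\<rho> < 1"
    "\<And>k q (g :: _ \<Rightarrow> real) (h :: _ \<Rightarrow> real) \<delta> B. \<lbrakk>g \<in> borel_measurable m; integrable m h; \<And>x. x \<in> space m \<Longrightarrow> \<bar>g x\<bar> \<le> B;
       AE x in m. \<forall>x'\<in>space m. (\<forall>i\<le>k. x i = x' i) \<longrightarrow> \<bar>g x - g x'\<bar> \<le> \<delta>\<rbrakk> \<Longrightarrow>
       \<bar>(LINT x|m. h ((left_shift ^^ (k + 1 + q)) x) * g x) - (LINT x|m. h x) * (LINT x|m. g x)\<bar>
         \<le> (2 * \<delta> + B * C * \<rho> ^ q) * (LINT x|m. \<bar>h x\<bar>)"
proof -
  obtain C \<rho> where C: "0 \<le> C" and \<rho>: "0 < \<rho>" "\<rho> < 1"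
    and kp: "\<And>q i j. \<bar>kpow P q i j / p $ j - 1\<bar> \<le> C * \<rho> ^ q" by (rule kpow_convergence) blast
  show ?thesis
  proof (rule that[OF C \<rho>])
    fix k q and g h :: "_ \<Rightarrow> real" and \<delta> B
    assume g [measurable]: "g \<in> borel_measurable m" and h: "integrable m h"
      and B: "\<And>x. x \<in> space m \<Longrightarrow> \<bar>g x\<bar> \<le> B"
      and osc: "AE x in m. \<forall>x'\<in>space m. (\<forall>i\<le>k. x i = x' i) \<longrightarrow> \<bar>g x - g x'\<bar> \<le> \<delta>"
    note [measurable] = borel_measurable_integrable[OF h]
    define N where "N = k + 1 + q"
    let ?W = "PiE {..k} (\<lambda>_. UNIV :: 'n set)"
    define c where "c w x = kpow P (Suc q) (w k) (x 0) / p $ x 0" for w x :: "nat \<Rightarrow> 'n"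
    \<comment> \<open>\<open>G\<close> samples \<open>g\<close> at one point of each cylinder.
      Forbidden words have empty cylinders; the default 0 keeps the bound \<open>B\<close>
      there.\<close>
    define G where "G w = (if cyl k w = {} then 0 else g (SOME x. x \<in> cyl k w))" for w
    define g' where "g' x = G (restrict x {..k})" for x
    have B0: "0 \<le> B" using not_empty B by fastforce
    have G: "\<bar>G w\<bar> \<le> B" for w
    proof (cases "cyl k w = {}")
      case False
      then have "(SOME x. x \<in> cyl k w) \<in> cyl k w" by (simp add: some_in_eq)
      then have "(SOME x. x \<in> cyl k w) \<in> space m" using sets.sets_into_space[OF sets_cyl] by blast
      then show ?thesis using B False by (simp add: G_def)
    qed (simp add: G_def B0)
    have g'_sum: "g' x = (\<Sum>w\<in>?W. G w * indicator (cyl k w) x)" if "x \<in> space m" for x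
      unfolding g'_def by (rule sum_indicator_cyl[OF that, symmetric])
    have [measurable]: "g' \<in> borel_measurable m"
      by (subst measurable_cong[OF g'_sum]) simp_all
    have g'B: "\<bar>g' x\<bar> \<le> B" for x by (simp add: g'_def G)
    have near: "AE x in m. \<bar>g x - g' x\<bar> \<le> \<delta>"
      using osc
    proof (rule AE_mp, intro AE_I2 impI)
      fix x assume x: "x \<in> space m" "\<forall>x'\<in>space m. (\<forall>i\<le>k. x i = x' i) \<longrightarrow> \<bar>g x - g x'\<bar> \<le> \<delta>"
      define x' where "x' = (SOME y. y \<in> cyl k (restrict x {..k}))"
      have ne: "x \<in> cyl k (restrict x {..k})" using x by (auto simp: cyl_def)
      then have "x' \<in> cyl k (restrict x {..k})"
        unfolding x'_def by (rule someI[where P="\<lambda>y. y \<in> cyl k (restrict x {..k})"])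
      moreover have "g' x = g x'" using ne by (auto simp: g'_def G_def x'_def)
      ultimately show "\<bar>g x - g' x\<bar> \<le> \<delta>" using x by (auto simp: cyl_def)
    qed
    show "\<bar>(LINT x|m. h ((left_shift ^^ (k + 1 + q)) x) * g x) - (LINT x|m. h x) * (LINT x|m. g x)\<bar>
         \<le> (2 * \<delta> + B * C * \<rho> ^ q) * (LINT x|m. \<bar>h x\<bar>)"
      unfolding N_def[symmetric]
    proof -
      let ?I = "LINT x|m. \<bar>h x\<bar>"
      define H where "H x = h ((left_shift ^^ N) x)" for x
      have H: "integrable m H" unfolding H_def by (rule integrable_shift[OF h])
      have intH: "(LINT x|m. \<bar>H x\<bar>) = ?I"
        unfolding H_def by (rule integral_shift[of "\<lambda>x. \<bar>h x\<bar>"]) simp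
      have i1: "\<bar>(LINT x|m. H x * g x) - (LINT x|m. H x * g' x)\<bar> \<le> \<delta> * ?I"
        using integral_mult_diff_le[OF H, of g g' B \<delta>] near B g'B unfolding intH by auto
      have "\<bar>(LINT x|m. 1 * g x) - (LINT x|m. 1 * g' x)\<bar> \<le> \<delta> * (LINT x|m. \<bar>1\<bar>)"
        using near B g'B by (intro integral_mult_diff_le[where B=B]) auto
      then have "\<bar>(LINT x|m. h x)\<bar> * \<bar>(LINT x|m. g x) - (LINT x|m. g' x)\<bar> \<le> ?I * \<delta>"
        by (intro mult_mono integral_abs_bound) (auto simp: prob_space)
      then have i2: "\<bar>(LINT x|m. h x) * (LINT x|m. g x) - (LINT x|m. h x) * (LINT x|m. g' x)\<bar> \<le> \<delta> * ?I"
        by (simp add: abs_mult right_diff_distrib mult.commute flip: abs_mult)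
      have "(LINT x|m. g' x) = (LINT x|m. (\<Sum>w\<in>?W. G w * indicator (cyl k w) x))"
        by (rule Bochner_Integration.integral_cong) (simp_all add: g'_sum)
      then have g'_int: "(LINT x|m. g' x) = (\<Sum>w\<in>?W. G w * measure m (cyl k w))"
        by (subst (asm) Bochner_Integration.integral_sum) (simp_all add: emeasure_eq_measure)
      have "(LINT x|m. H x * g' x) = (LINT x|m. (\<Sum>w\<in>?W. G w * (indicator (cyl k w) x * H x)))"
        by (rule Bochner_Integration.integral_cong) (simp_all add: g'_sum sum_distrib_left mult_ac)
      also have "\<dots> = (\<Sum>w\<in>?W. G w * (LINT x|m. indicator (cyl k w) x * H x))"
        using integrable_mult_indicator[OF sets_cyl H] by (subst Bochner_Integration.integral_sum) simp_all
      also have "\<dots> = (\<Sum>w\<in>?W. G w * (measure m (cyl k w) * (LINT x|m. c w x * h x)))"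
        using integral_cylinder_shift[of h k _ q] unfolding H_def N_def c_def by simp
      finally have Hg': "(LINT x|m. H x * g' x) = (\<Sum>w\<in>?W. G w * (measure m (cyl k w) * (LINT x|m. c w x * h x)))" .
      have cw: "\<bar>(LINT x|m. c w x * h x) - (LINT x|m. h x)\<bar> \<le> C * \<rho> ^ q * ?I" for w
      proof -
        have [measurable]: "c w \<in> borel_measurable m"
          unfolding c_def by (rule measurable_compose[OF measurable_coord[of 0]]) simp
        have c1: "\<bar>c w x - 1\<bar> \<le> C * \<rho> ^ q" for x
        proof -
          have "\<bar>c w x - 1\<bar> \<le> C * \<rho> ^ Suc q" unfolding c_def by (rule kp)
          also have "\<dots> \<le> C * \<rho> ^ q" using \<rho> C by (intro mult_left_mono power_decreasing) auto
          finally show ?thesis .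
        qed
        have "\<bar>c w x\<bar> \<le> C * \<rho> ^ q + 1" for x using c1[of x] by linarith
        moreover have "0 \<le> C * \<rho> ^ q" using \<rho> C by simp
        ultimately have "\<bar>(LINT x|m. h x * c w x) - (LINT x|m. h x * 1)\<bar> \<le> C * \<rho> ^ q * ?I"
          using c1 by (intro integral_mult_diff_le[OF h, where B="C * \<rho> ^ q + 1"]) auto
        then show ?thesis by (simp add: mult.commute)
      qed
      have "\<bar>(LINT x|m. H x * g' x) - (LINT x|m. h x) * (LINT x|m. g' x)\<bar>
          = \<bar>\<Sum>w\<in>?W. G w * (measure m (cyl k w) * ((LINT x|m. c w x * h x) - (LINT x|m. h x)))\<bar>"
        unfolding Hg' g'_int by (simp add: sum_distrib_left sum_subtractf right_diff_distrib mult_ac)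
      also have "\<dots> \<le> (\<Sum>w\<in>?W. B * (measure m (cyl k w) * (C * \<rho> ^ q * ?I)))"
        by (rule order_trans[OF sum_abs], rule sum_mono, unfold abs_mult, intro mult_mono G order_refl cw)
           (auto simp: B0 intro!: cw)
      \<comment> \<open>The cylinder measures sum to 1, so the error does not grow with the number
        of words.\<close>
      also have "\<dots> = B * (C * \<rho> ^ q * ?I) * (\<Sum>w\<in>?W. measure m (cyl k w))"
        by (simp add: sum_distrib_left mult_ac)
      finally have i3: "\<bar>(LINT x|m. H x * g' x) - (LINT x|m. h x) * (LINT x|m. g' x)\<bar> \<le> B * (C * \<rho> ^ q * ?I)"
        by (simp only: sum_measure_cyl mult_1_right)
      have "\<bar>(LINT x|m. H x * g x) - (LINT x|m. h x) * (LINT x|m. g x)\<bar> \<le> \<delta> * ?I + B * (C * \<rho> ^ q * ?I) + \<delta> * ?I"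
        using i1 i2 i3 by linarith
      then show "\<bar>(LINT x|m. h ((left_shift ^^ N) x) * g x) - (LINT x|m. h x) * (LINT x|m. g x)\<bar>
         \<le> (2 * \<delta> + B * C * \<rho> ^ q) * ?I"
        unfolding H_def by (simp add: algebra_simps)
    qed
  qed
qed

section \<open>Uniqueness of the invariant measure with Lipschitz density\<close>

lemma lip_bound_bounded:
  assumes \<theta>: "0 < \<theta>" "\<theta> < 1" and f: "lip_bound (shift_space A) (dtheta \<theta>) f L"
  shows "\<exists>B. \<forall>x\<in>space m. \<bar>f x\<bar> \<le> B"
proof -
  obtain x0 where x0: "x0 \<in> space m" using not_empty by blast
  have "\<bar>f x\<bar> \<le> \<bar>f x0\<bar> + L * (1 / (1 - \<theta>))" if "x \<in> space m" for x
  proof -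
    have "\<bar>f x - f x0\<bar> \<le> L * dtheta \<theta> x x0" using f that x0 by (auto simp: lip_bound_def space_eq)
    also have "\<dots> \<le> L * (1 / (1 - \<theta>))"
      using f dtheta_le[OF \<theta>, of 0 x x0] by (intro mult_left_mono) (auto simp: lip_bound_def)
    finally show ?thesis by linarith
  qed
  then show ?thesis by blast
qed

text \<open>By invariance the measure of \<open>E\<close> under \<open>\<nu>\<close> is the
  correlation of \<open>f\<close> with the indicator of \<open>E\<close> after any number of shifts.
  Mixing drives this correlation to the product of the integrals, which is the measure of
  \<open>E\<close> under \<open>m\<close> since \<open>f\<close> has integral 1.\<close>

lemma invariant_lipschitz_density_eq:
  assumes \<theta>: "0 < \<theta>" "\<theta> < 1" and L: "lip_bound (shift_space A) (dtheta \<theta>) f L" and f: "integrable m f"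
    and sets: "sets \<nu> = sets m" and "prob_space \<nu>"
    and \<nu>: "\<And>E. E \<in> sets m \<Longrightarrow> measure \<nu> E = (LINT x:E|m. f x)"
    and inv: "distr \<nu> \<nu> left_shift = \<nu>"
  shows "\<nu> = m"
proof (rule measure_eqI[OF sets])
  interpret \<nu>: prob_space \<nu> by fact
  note [measurable] = borel_measurable_integrable[OF f]
  obtain C \<rho> where C: "0 \<le> C" and \<rho>: "0 < \<rho>" "\<rho> < 1" and decay:
    "\<And>k q (g :: _ \<Rightarrow> real) (h :: _ \<Rightarrow> real) \<delta> B. \<lbrakk>g \<in> borel_measurable m; integrable m h; \<And>x. x \<in> space m \<Longrightarrow> \<bar>g x\<bar> \<le> B;
       AE x in m. \<forall>x'\<in>space m. (\<forall>i\<le>k. x i = x' i) \<longrightarrow> \<bar>g x - g x'\<bar> \<le> \<delta>\<rbrakk> \<Longrightarrow>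
       \<bar>(LINT x|m. h ((left_shift ^^ (k + 1 + q)) x) * g x) - (LINT x|m. h x) * (LINT x|m. g x)\<bar>
         \<le> (2 * \<delta> + B * C * \<rho> ^ q) * (LINT x|m. \<bar>h x\<bar>)"
    by (rule decay_of_correlations) blast
  obtain B where B: "\<And>x. x \<in> space m \<Longrightarrow> \<bar>f x\<bar> \<le> B" using lip_bound_bounded[OF \<theta> L] by blast
  have space: "space \<nu> = space m" using sets by (rule sets_eq_imp_space_eq)
  have shift\<nu>: "left_shift \<in> \<nu> \<rightarrow>\<^sub>M \<nu>"
    unfolding measurable_cong_sets[OF sets sets] by (rule measurable_left_shift)
  have total: "(LINT x|m. f x) = 1"
    using \<nu>[of "space m"] \<nu>.prob_space unfolding space set_lebesgue_integral_def
    by (simp cong: Bochner_Integration.integral_cong)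
  fix E assume "E \<in> sets \<nu>"
  then have E [measurable]: "E \<in> sets m" by (simp add: sets)
  have mE: "(LINT x|m. indicator E x) = measure m E" by simp
  have "\<bar>measure \<nu> E - measure m E\<bar> \<le> (2 * (L * (\<theta> ^ Suc k / (1 - \<theta>))) + B * C * \<rho> ^ k) * measure m E" for k
  proof -
    \<comment> \<open>Cylinder depth and gap are both \<open>k\<close>, so that the oscillation
      error and the mixing error vanish together as \<open>k\<close> grows.\<close>
    define T :: "(nat \<Rightarrow> 'n) \<Rightarrow> nat \<Rightarrow> 'n" where "T = left_shift ^^ (k + 1 + k)"
    have T [measurable]: "T \<in> m \<rightarrow>\<^sub>M m" unfolding T_def by measurable
    have "measure \<nu> E = measure (distr \<nu> \<nu> T) E" by (simp only: T_def distr_funpow[OF shift\<nu> inv])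
    also have "\<dots> = measure \<nu> (T -` E \<inter> space m)"
      using measurable_funpow[OF shift\<nu>] E by (simp only: T_def measure_distr sets space)
    also have "\<dots> = (LINT x:T -` E \<inter> space m|m. f x)" by (rule \<nu>) simp
    also have "\<dots> = (LINT x|m. indicator E (T x) * f x)"
      unfolding set_lebesgue_integral_def by (rule Bochner_Integration.integral_cong) (auto simp: indicator_def)
    finally have eq: "measure \<nu> E = (LINT x|m. indicator E (T x) * f x)" .
    have "AE x in m. \<forall>x'\<in>space m. (\<forall>i\<le>k. x i = x' i) \<longrightarrow> \<bar>f x - f x'\<bar> \<le> L * (\<theta> ^ Suc k / (1 - \<theta>))"
    proof (rule AE_I2, intro ballI impI)
      fix x x' assume x: "x \<in> space m" "x' \<in> space m" "\<forall>i\<le>k. x i = x' i"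
      then have "\<bar>f x - f x'\<bar> \<le> L * dtheta \<theta> x x'" using L by (auto simp: lip_bound_def space_eq)
      also have "\<dots> \<le> L * (\<theta> ^ Suc k / (1 - \<theta>))"
        using L x(3) by (intro mult_left_mono dtheta_le \<theta>) (auto simp: lip_bound_def less_Suc_eq_le)
      finally show "\<bar>f x - f x'\<bar> \<le> L * (\<theta> ^ Suc k / (1 - \<theta>))" .
    qed
    from decay[OF _ _ B this, of "indicator E" k] show ?thesis
      unfolding T_def[symmetric] eq[symmetric] mE total by (simp add: emeasure_eq_measure)
  qed
  moreover have "(\<lambda>k. (2 * (L * (\<theta> ^ Suc k / (1 - \<theta>))) + B * C * \<rho> ^ k) * measure m E)
      \<longlonglongrightarrow> (2 * (L * (0 / (1 - \<theta>))) + B * C * 0) * measure m E"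
    using \<theta> \<rho> by (intro tendsto_intros LIMSEQ_Suc[OF LIMSEQ_power_zero] LIMSEQ_power_zero) auto
  ultimately have "\<bar>measure \<nu> E - measure m E\<bar> \<le> (2 * (L * (0 / (1 - \<theta>))) + B * C * 0) * measure m E"
    by (intro LIMSEQ_le_const) auto
  then show "emeasure \<nu> E = emeasure m E" by (simp add: \<nu>.emeasure_eq_measure emeasure_eq_measure)
qed

end

section \<open>Skew products with contracting fibres\<close>

lemma skew_funpow_fst: "fst ((skew G ^^ n) z) = (left_shift ^^ n) (fst z)"
  by (induction n) (simp_all add: skew_def case_prod_beta)

lemma skew_funpow_snd_Suc:
  "snd ((skew G ^^ Suc n) z) = G ((left_shift ^^ n) (fst z), snd ((skew G ^^ n) z))"
  using skew_funpow_fst[of n G z] by (simp add: skew_def case_prod_beta)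

text \<open>Difference quotients are lower bounds for all admissible constants, so the infimum is
  itself admissible; boundedness of \<open>d\<close> makes the supremum finite. Hence the norm can
  serve as both a sup bound and a Lipschitz constant.\<close>

lemma lip_norm_bounds:
  assumes X: "X \<noteq> {}" and d: "\<And>x y. x \<in> X \<Longrightarrow> y \<in> X \<Longrightarrow> 0 \<le> d x y \<and> d x y \<le> D"
    and f: "f \<in> lip_functions X d"
  shows "x \<in> X \<Longrightarrow> \<bar>f x\<bar> \<le> lip_norm X d f" and "lip_bound X d f (lip_norm X d f)"
proof -
  obtain L where L: "lip_bound X d f L" using f by (auto simp: lip_functions_def)
  obtain x0 where x0: "x0 \<in> X" using X by blast
  let ?Ls = "{L. lip_bound X d f L}"
  have "\<bar>f x\<bar> \<le> \<bar>f x0\<bar> + L * D" if "x \<in> X" for x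
  proof -
    have "\<bar>f x - f x0\<bar> \<le> L * d x x0" using L that x0 by (auto simp: lip_bound_def)
    also have "\<dots> \<le> L * D" using L d[OF that x0] by (intro mult_left_mono) (auto simp: lip_bound_def)
    finally show ?thesis by linarith
  qed
  then have "bdd_above ((\<lambda>x. \<bar>f x\<bar>) ` X)" by (intro bdd_aboveI2) auto
  then have sup: "\<bar>f x\<bar> \<le> (SUP x\<in>X. \<bar>f x\<bar>)" if "x \<in> X" for x by (rule cSUP_upper[OF that])
  have sup0: "0 \<le> (SUP x\<in>X. \<bar>f x\<bar>)" using sup[OF x0] by linarith
  have inf0: "0 \<le> Inf ?Ls" using L by (intro cInf_greatest) (auto simp: lip_bound_def)
  show "\<bar>f x\<bar> \<le> lip_norm X d f" if "x \<in> X"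
    using sup[OF that] inf0 by (simp add: lip_norm_def)
  have "\<bar>f x - f y\<bar> \<le> Inf ?Ls * d x y" if xy: "x \<in> X" "y \<in> X" for x y
  proof (cases "d x y = 0")
    \<comment> \<open>No quotient exists at distance zero, but any admissible constant already
      forces equal values.\<close>
    case True
    have "\<bar>f x - f y\<bar> \<le> L * d x y" using L xy by (auto simp: lip_bound_def)
    then show ?thesis using True by simp
  next
    case False
    then have pos: "0 < d x y" using d[OF xy] by simp
    then have "\<bar>f x - f y\<bar> / d x y \<le> Inf ?Ls"
      using L xy by (intro cInf_greatest) (auto simp: lip_bound_def divide_le_eq)
    then show ?thesis using pos by (simp add: divide_le_eq)
  qed
  moreover have "Inf ?Ls * d x y \<le> lip_norm X d f * d x y" if "x \<in> X" "y \<in> X" for x y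
    using sup0 d[OF that] by (intro mult_right_mono) (auto simp: lip_norm_def)
  ultimately have "\<bar>f x - f y\<bar> \<le> lip_norm X d f * d x y" if "x \<in> X" "y \<in> X" for x y
    using that order_trans by blast
  moreover have "0 \<le> lip_norm X d f" using sup0 inf0 by (simp add: lip_norm_def)
  ultimately show "lip_bound X d f (lip_norm X d f)" by (simp add: lip_bound_def)
qed

section \<open>Fibre contraction along orbits and regularity of the iterates\<close>

locale contracting_skew_product = markov_shift A p P m
  for A :: "nat^'n^'n" and p P m +
  fixes \<theta> \<alpha> c :: real and G :: "(nat \<Rightarrow> 'n) \<times> 'k::polish_space \<Rightarrow> 'k"
  assumes \<theta>: "0 < \<theta>" "\<theta> < 1" and \<alpha>: "0 < \<alpha>" "\<alpha> < 1" and c: "0 \<le> c"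
    and diam: "dist (y1 :: 'k) y2 \<le> 1"
    and G_measurable [measurable]: "G \<in> m \<Otimes>\<^sub>M borel \<rightarrow>\<^sub>M borel"
    and contraction: "AE x in m. \<forall>y1 y2. dist (G (x, y1)) (G (x, y2)) \<le> \<alpha> * dist y1 y2"
    and base_lipschitz: "x1 \<in> space m \<Longrightarrow> x2 \<in> space m \<Longrightarrow> dist (G (x1, y)) (G (x2, y)) \<le> c * dtheta \<theta> x1 x2"
begin

lemma measurable_skew [measurable]: "skew G \<in> m \<Otimes>\<^sub>M borel \<rightarrow>\<^sub>M m \<Otimes>\<^sub>M borel"
  unfolding skew_def by measurable

text \<open>The contraction is demanded along the whole forward orbit, so that it can be
  iterated.\<close>

definition good :: "(nat \<Rightarrow> 'n) \<Rightarrow> bool" where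
  "good x \<longleftrightarrow> x \<in> space m \<and>
    (\<forall>j y1 y2. dist (G ((left_shift ^^ j) x, y1)) (G ((left_shift ^^ j) x, y2)) \<le> \<alpha> * dist y1 y2)"

text \<open>Invariance of \<open>m\<close> carries the almost sure contraction to each shifted
  point, and there are countably many shifts.\<close>

lemma AE_good: "AE x in m. good x"
proof -
  have "AE x in m. \<forall>y1 y2. dist (G ((left_shift ^^ j) x, y1)) (G ((left_shift ^^ j) x, y2)) \<le> \<alpha> * dist y1 y2" for j
    by (rule AE_distrD[OF measurable_left_shift_funpow[of j]]) (simp only: distr_left_shift_funpow contraction)
  then have "AE x in m. \<forall>j y1 y2. dist (G ((left_shift ^^ j) x, y1)) (G ((left_shift ^^ j) x, y2)) \<le> \<alpha> * dist y1 y2"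
    by (simp add: AE_all_countable)
  with AE_space show ?thesis by eventually_elim (simp add: good_def)
qed

lemma fibre_contraction:
  assumes "good x"
  shows "dist (snd ((skew G ^^ n) (x, y1))) (snd ((skew G ^^ n) (x, y2))) \<le> \<alpha> ^ n"
proof (induction n)
  case 0
  then show ?case using diam by simp
next
  case (Suc n)
  have "dist (snd ((skew G ^^ Suc n) (x, y1))) (snd ((skew G ^^ Suc n) (x, y2)))
      \<le> \<alpha> * dist (snd ((skew G ^^ n) (x, y1))) (snd ((skew G ^^ n) (x, y2)))"
    using assms unfolding skew_funpow_snd_Suc by (simp add: good_def)
  also have "\<dots> \<le> \<alpha> * \<alpha> ^ n" using Suc \<alpha> by (intro mult_left_mono) auto
  finally show ?case by simp
qed

lemma dtheta_funpow_le:
  assumes "\<And>i. i < n + l \<Longrightarrow> x i = x' i"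
  shows "dtheta \<theta> ((left_shift ^^ n) x) ((left_shift ^^ n) x') \<le> \<theta> ^ l / (1 - \<theta>)"
  by (rule dtheta_le[OF \<theta>]) (use assms in \<open>auto simp: left_shift_funpow\<close>)

lemma left_shift_funpow_in: "x \<in> space m \<Longrightarrow> (left_shift ^^ n) x \<in> space m"
  by (rule measurable_space[OF measurable_left_shift_funpow])

text \<open>The solution of \<open>\<alpha> * K + c / (1 - \<theta>) = K\<close>, the equation that
  closes the induction on \<open>n\<close> below.\<close>

definition K :: real where "K = c / ((1 - \<theta>) * (1 - \<alpha>))"

lemma K_nonneg: "0 \<le> K"
  using c \<theta> \<alpha> by (simp add: K_def)

text \<open>
  The errors made along the orbit are damped by the fibre contraction, so that the bound does not
  grow with \<open>n\<close> although the shift expands distances.  The contraction is needed only along the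
  orbit of \<open>x\<close>, hence only almost everywhere.
\<close>

lemma base_variation:
  assumes x: "good x" "x' \<in> space m" and "\<And>i. i < n + l \<Longrightarrow> x i = x' i"
  shows "dist (snd ((skew G ^^ n) (x, y))) (snd ((skew G ^^ n) (x', y))) \<le> K * \<theta> ^ l"
  using assms(3)
proof (induction n arbitrary: l)
  case 0
  then show ?case using K_nonneg \<theta> by simp
next
  case (Suc n)
  let ?x = "(left_shift ^^ n) x" and ?x' = "(left_shift ^^ n) x'"
  let ?y = "snd ((skew G ^^ n) (x, y))" and ?y' = "snd ((skew G ^^ n) (x', y))"
  \<comment> \<open>One iterate is traded for one more common coordinate: the induction hypothesis
    is used with \<open>Suc l\<close>, since \<open>n + Suc l = Suc n + l\<close>.\<close>
  have agree: "x i = x' i" if "i < n + Suc l" for i using Suc.prems that by simp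
  have "dist (G (?x, ?y)) (G (?x', ?y')) \<le> dist (G (?x, ?y)) (G (?x, ?y')) + dist (G (?x, ?y')) (G (?x', ?y'))"
    by (rule dist_triangle)
  also have "\<dots> \<le> \<alpha> * dist ?y ?y' + c * dtheta \<theta> ?x ?x'"
    using x by (intro add_mono base_lipschitz left_shift_funpow_in) (auto simp: good_def)
  also have "\<dots> \<le> \<alpha> * (K * \<theta> ^ Suc l) + c * (\<theta> ^ Suc l / (1 - \<theta>))"
    using \<alpha> c by (intro add_mono mult_left_mono Suc.IH dtheta_funpow_le agree) auto
  also have "\<dots> = (\<alpha> * K + c / (1 - \<theta>)) * \<theta> ^ Suc l" by (simp add: algebra_simps)
  also have "\<alpha> * K + c / (1 - \<theta>) = K"
  proof -
    have "c / (1 - \<theta>) = K * (1 - \<alpha>)" using \<alpha> by (simp add: K_def)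
    then show ?thesis by (simp add: algebra_simps)
  qed
  also have "K * \<theta> ^ Suc l \<le> K * \<theta> ^ l"
    using \<theta> K_nonneg by (intro mult_left_mono power_decreasing) auto
  finally show ?case unfolding skew_funpow_snd_Suc by simp
qed

text \<open>The Lipschitz bound refers to \<open>skew_dist\<close>, measurability to the product
  sigma-algebra. On each cylinder the base point is frozen at a representative, leaving a continuous
  function of the fibre; these finite sums converge pointwise to \<open>\<phi>\<close>.\<close>

lemma measurable_H_space:
  assumes "lip_bound (shift_space A \<times> UNIV) (skew_dist \<theta>) \<phi> L"
  shows "\<phi> \<in> borel_measurable (m \<Otimes>\<^sub>M (borel :: 'k measure))"
proof (rule borel_measurable_LIMSEQ_real)
  have L: "0 \<le> L" "\<And>u v. u \<in> space m \<times> UNIV \<Longrightarrow> v \<in> space m \<times> UNIV \<Longrightarrow> \<bar>\<phi> u - \<phi> v\<bar> \<le> L * skew_dist \<theta> u v"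
    using assms by (auto simp: lip_bound_def space_eq)
  define r where "r k w = (SOME x. x \<in> cyl k w)" for k w
  have r: "r k w \<in> cyl k w" if "x \<in> cyl k w" for x k w
    unfolding r_def using that by (rule someI[where P="\<lambda>x. x \<in> cyl k w"])
  define \<phi>' where "\<phi>' k w y = (if cyl k w = {} then 0 else \<phi> (r k w, y))" for k w y
  define s where "s k z = (\<Sum>w\<in>PiE {..k} (\<lambda>_. UNIV). \<phi>' k w (snd z) * indicator (cyl k w) (fst z))" for k and z :: "_ \<times> 'k"
  have "continuous_on UNIV (\<phi>' k w)" for k w
  proof (cases "cyl k w = {}")
    case False
    then have "r k w \<in> cyl k w" using r by blast
    then have "r k w \<in> space m" by (simp add: cyl_def)
    then have "L-lipschitz_on UNIV (\<lambda>y. \<phi> (r k w, y))"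
      using L by (intro lipschitz_onI) (force simp: dist_real_def skew_dist_def dtheta_def)+
    then have "continuous_on UNIV (\<lambda>y. \<phi> (r k w, y))" by (rule lipschitz_on_continuous_on)
    then show ?thesis using False by (simp add: \<phi>'_def)
  qed (simp add: \<phi>'_def)
  then have [measurable]: "\<phi>' k w \<in> borel_measurable borel" for k w by (rule borel_measurable_continuous_onI)
  show "s k \<in> borel_measurable (m \<Otimes>\<^sub>M borel)" for k
    unfolding s_def by measurable
  fix z assume "z \<in> space (m \<Otimes>\<^sub>M (borel :: 'k measure))"
  then have z: "fst z \<in> space m" by (auto simp: space_pair_measure)
  have "\<bar>s k z - \<phi> z\<bar> \<le> L * (\<theta> ^ Suc k / (1 - \<theta>))" for k
  proof -
    let ?w = "restrict (fst z) {..k}"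
    have w: "fst z \<in> cyl k ?w" using z by (simp add: cyl_def)
    have rw: "r k ?w \<in> space m" "\<And>i. i < Suc k \<Longrightarrow> r k ?w i = fst z i"
      using r[OF w] by (auto simp: cyl_def less_Suc_eq_le)
    have "s k z = \<phi>' k ?w (snd z)"
      unfolding s_def by (rule sum_indicator_cyl[OF z])
    also have "\<dots> = \<phi> (r k ?w, snd z)" using w by (auto simp: \<phi>'_def)
    finally have "\<bar>s k z - \<phi> z\<bar> \<le> L * skew_dist \<theta> (r k ?w, snd z) z"
      using L(2)[of "(r k ?w, snd z)" z] z rw by (cases z) simp
    also have "\<dots> \<le> L * (\<theta> ^ Suc k / (1 - \<theta>))"
      using dtheta_le[OF \<theta>, of "Suc k" "r k ?w" "fst z"] rw(2) L(1)
      by (intro mult_left_mono) (simp_all add: skew_dist_def)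
    finally show ?thesis .
  qed
  then have "\<forall>\<^sub>F k in sequentially. norm (s k z - \<phi> z) \<le> L * (\<theta> ^ Suc k / (1 - \<theta>))"
    by (intro always_eventually allI) (simp only: real_norm_def)
  moreover have "(\<lambda>k. L * (\<theta> ^ Suc k / (1 - \<theta>))) \<longlonglongrightarrow> L * (0 / (1 - \<theta>))"
    using \<theta> by (intro tendsto_intros LIMSEQ_Suc[OF LIMSEQ_power_zero]) auto
  then have "(\<lambda>k. L * (\<theta> ^ Suc k / (1 - \<theta>))) \<longlonglongrightarrow> 0" by (simp only: div_0 mult_zero_right)
  ultimately have "(\<lambda>k. s k z - \<phi> z) \<longlonglongrightarrow> 0" by (rule Lim_null_comparison)
  then show "(\<lambda>k. s k z) \<longlonglongrightarrow> \<phi> z" by (simp add: LIM_zero_iff)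
qed

text \<open>A single \<open>b\<close> bounds both the values and the Lipschitz constant of
  \<open>\<phi>\<close>, which makes the estimate linear in \<open>b\<close>. The marginal being
  \<open>m\<close> turns integrals of base functions over \<open>\<mu>\<close> into integrals over
  \<open>m\<close>.\<close>

lemma skew_decay_of_correlations:
  fixes \<mu> :: "((nat \<Rightarrow> 'n) \<times> 'k) measure"
  assumes \<mu>: "prob_space \<mu>" "sets \<mu> = sets (m \<Otimes>\<^sub>M borel)" "distr \<mu> \<mu> (skew G) = \<mu>" "distr \<mu> m fst = m"
  obtains \<tau> C where "0 < \<tau>" "\<tau> < 1" "0 \<le> C"
    "\<And>(\<psi> :: _ \<times> 'k \<Rightarrow> real) h (\<phi> :: _ \<times> 'k \<Rightarrow> real) b n. \<lbrakk>\<And>x y. x \<in> space m \<Longrightarrow> \<psi> (x, y) = h x; integrable m h;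
       lip_bound (shift_space A \<times> UNIV) (skew_dist \<theta>) \<phi> b; \<And>z. fst z \<in> space m \<Longrightarrow> \<bar>\<phi> z\<bar> \<le> b; n \<ge> 1\<rbrakk> \<Longrightarrow>
       \<bar>(LINT z|\<mu>. \<psi> ((skew G ^^ n) z) * \<phi> z) - (LINT z|\<mu>. \<psi> z) * (LINT z|\<mu>. \<phi> z)\<bar>
         \<le> \<tau> ^ n * (C * (LINT x|m. \<bar>h x\<bar>) * b)"
proof -
  interpret \<mu>: prob_space \<mu> by fact
  obtain C \<rho> where C: "0 \<le> C" and \<rho>: "0 < \<rho>" "\<rho> < 1" and decay:
    "\<And>k q (g :: _ \<Rightarrow> real) (h :: _ \<Rightarrow> real) \<delta> B. \<lbrakk>g \<in> borel_measurable m; integrable m h; \<And>x. x \<in> space m \<Longrightarrow> \<bar>g x\<bar> \<le> B;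
       AE x in m. \<forall>x'\<in>space m. (\<forall>i\<le>k. x i = x' i) \<longrightarrow> \<bar>g x - g x'\<bar> \<le> \<delta>\<rbrakk> \<Longrightarrow>
       \<bar>(LINT x|m. h ((left_shift ^^ (k + 1 + q)) x) * g x) - (LINT x|m. h x) * (LINT x|m. g x)\<bar>
         \<le> (2 * \<delta> + B * C * \<rho> ^ q) * (LINT x|m. \<bar>h x\<bar>)"
    by (rule decay_of_correlations) blast
  have space\<mu>: "space \<mu> = space m \<times> UNIV"
    using sets_eq_imp_space_eq[OF \<mu>(2)] by (simp add: space_pair_measure)
  \<comment> \<open>A common bound for the rates of base regularity, mixing and fibre
    contraction.\<close>
  define \<beta> where "\<beta> = max \<theta> (max \<rho> \<alpha>)"
  have \<beta>: "0 < \<beta>" "\<beta> < 1" "\<theta> \<le> \<beta>" "\<rho> \<le> \<beta>" "\<alpha> \<le> \<beta>" using \<theta> \<rho> \<alpha> by (auto simp: \<beta>_def)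
  \<comment> \<open>The first summand comes from the distance of the shifted base points, the second
    from \<open>base_variation\<close>.\<close>
  define K' where "K' = 1 / (1 - \<theta>) + K"
  have K': "0 \<le> K'" using \<theta> K_nonneg by (simp add: K'_def)
  \<comment> \<open>The 2 stems from replacing \<open>\<phi>\<close> in two integrals,
    \<open>2 * K'\<close> from oscillation and \<open>C\<close> from mixing. Dividing by
    \<open>\<beta>\<close> pays for rounding: \<open>n \<le> 2 * l + 2\<close> gives
    \<open>\<beta> ^ l \<le> sqrt \<beta> ^ n / \<beta>\<close>.\<close>
  define C' where "C' = (2 + 2 * K' + C) / \<beta>"
  have measurable_\<mu> [simp]: "f \<in> \<mu> \<rightarrow>\<^sub>M N \<longleftrightarrow> f \<in> m \<Otimes>\<^sub>M borel \<rightarrow>\<^sub>M N" for f and N :: "'z measure"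
    by (simp only: measurable_cong_sets[OF \<mu>(2) refl])
  have fst\<mu>: "fst \<in> \<mu> \<rightarrow>\<^sub>M m" by simp
  have F: "skew G \<in> \<mu> \<rightarrow>\<^sub>M \<mu>"
    by (simp only: measurable_cong_sets[OF \<mu>(2) \<mu>(2)] measurable_skew)
  note Fn = measurable_funpow[OF F]
  show ?thesis
  proof (rule that[of "sqrt \<beta>" C'])
    fix \<psi> \<phi> :: "_ \<times> 'k \<Rightarrow> real" and h :: "_ \<Rightarrow> real" and b and n :: nat
    assume \<psi>: "\<And>x y. x \<in> space m \<Longrightarrow> \<psi> (x, y) = h x" and h: "integrable m h"
      and \<phi>: "lip_bound (shift_space A \<times> UNIV) (skew_dist \<theta>) \<phi> b" and b: "\<And>z. fst z \<in> space m \<Longrightarrow> \<bar>\<phi> z\<bar> \<le> b"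
      and n: "n \<ge> 1"
    note [measurable] = borel_measurable_integrable[OF h] measurable_H_space[OF \<phi>]
    \<comment> \<open>Depth \<open>n + l\<close> and gap \<open>q\<close> make the total shift
      \<open>n + l + 1 + q\<close> equal to \<open>2 * n\<close>, and \<open>l \<le> q\<close> lets
      both errors be measured by \<open>\<beta> ^ l\<close>.\<close>
    define l where "l = (n - 1) div 2"
    define q where "q = n - 1 - l"
    have lq: "l \<le> q" "l \<le> n" "n \<le> 2 * l + 2" "n + l + 1 + q = n + n" using n by (auto simp: l_def q_def)
    \<comment> \<open>An arbitrary reference point of the fibre; the contraction makes the choice
      immaterial up to \<open>\<alpha> ^ n\<close>.\<close>
    define y0 :: 'k where "y0 = undefined"
    define I where "I = (LINT x|m. \<bar>h x\<bar>)"
    have I: "0 \<le> I" unfolding I_def by (rule Bochner_Integration.integral_nonneg) simp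
    have b0: "0 \<le> b" using \<phi> by (simp add: lip_bound_def)
    have lip: "\<bar>\<phi> u - \<phi> v\<bar> \<le> b * (dtheta \<theta> (fst u) (fst v) + dist (snd u) (snd v))"
      if "fst u \<in> space m" "fst v \<in> space m" for u v
    proof -
      have "u \<in> shift_space A \<times> UNIV" "v \<in> shift_space A \<times> UNIV"
        using that by (simp_all add: space_eq mem_Times_iff)
      then show ?thesis using \<phi> unfolding lip_bound_def skew_dist_def by blast
    qed
    define \<Phi> where "\<Phi> x = \<phi> ((skew G ^^ n) (x, y0))" for x
    define H where "H x = h ((left_shift ^^ (n + n)) x)" for x
    have skewn [measurable]: "skew G ^^ n \<in> m \<Otimes>\<^sub>M borel \<rightarrow>\<^sub>M m \<Otimes>\<^sub>M borel"
      by (rule measurable_funpow[OF measurable_skew])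
    have \<Phi> [measurable]: "\<Phi> \<in> borel_measurable m" unfolding \<Phi>_def by measurable
    have iter_in: "fst ((skew G ^^ n) z) \<in> space m" if "fst z \<in> space m" for z
      using that by (simp add: skew_funpow_fst left_shift_funpow_in)
    have \<Phi>_le: "\<bar>\<Phi> x\<bar> \<le> b" if "x \<in> space m" for x
      unfolding \<Phi>_def using that by (intro b iter_in) simp
    have H: "integrable m H" unfolding H_def by (rule integrable_shift[OF h])
    have [measurable]: "H \<in> borel_measurable m" using H by simp
    have intH: "(LINT x|m. \<bar>H x\<bar>) = I"
      unfolding H_def I_def by (rule integral_shift[of "\<lambda>x. \<bar>h x\<bar>"]) simp
    have push: "(LINT z|\<mu>. f (fst z)) = (LINT x|m. f x)" if "f \<in> borel_measurable m" for f :: "_ \<Rightarrow> real"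
      using integral_distr[OF fst\<mu> that] by (simp add: \<mu>(4))
    have inv: "(LINT z|\<mu>. f ((skew G ^^ n) z)) = (LINT z|\<mu>. f z)" if "f \<in> borel_measurable (m \<Otimes>\<^sub>M borel)" for f :: "_ \<Rightarrow> real"
      using integral_distr[OF Fn, of f n] that distr_funpow[OF F \<mu>(3), of n] by simp
    have "integrable (distr \<mu> m fst) H" by (simp add: \<mu>(4) H)
    then have H\<mu>: "integrable \<mu> (\<lambda>z. H (fst z))" by (rule integrable_distr[OF fst\<mu>])
    have \<psi>h: "(LINT z|\<mu>. \<psi> z) = (LINT x|m. h x)"
    proof -
      have "(LINT z|\<mu>. \<psi> z) = (LINT z|\<mu>. h (fst z))"
        by (rule Bochner_Integration.integral_cong) (auto simp: space\<mu> \<psi>)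
      then show ?thesis by (simp add: push)
    qed
    have "(LINT z|\<mu>. \<psi> ((skew G ^^ n) z) * \<phi> z) = (LINT z|\<mu>. h ((left_shift ^^ n) (fst z)) * \<phi> z)"
    proof (rule Bochner_Integration.integral_cong[OF refl])
      fix z assume "z \<in> space \<mu>"
      then have "fst ((skew G ^^ n) z) \<in> space m" by (intro iter_in) (auto simp: space\<mu>)
      then have "\<psi> ((skew G ^^ n) z) = h (fst ((skew G ^^ n) z))"
        by (metis \<psi> prod.collapse)
      then show "\<psi> ((skew G ^^ n) z) * \<phi> z = h ((left_shift ^^ n) (fst z)) * \<phi> z"
        by (simp add: skew_funpow_fst)
    qed
    \<comment> \<open>Invariance of \<open>\<mu>\<close> delays both factors by \<open>n\<close>,
      after which the initial fibre coordinate is nearly forgotten.\<close>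
    also have "\<dots> = (LINT z|\<mu>. h ((left_shift ^^ n) (fst ((skew G ^^ n) z))) * \<phi> ((skew G ^^ n) z))"
      by (rule inv[symmetric]) measurable
    also have "\<dots> = (LINT z|\<mu>. H (fst z) * \<phi> ((skew G ^^ n) z))"
      by (simp add: H_def skew_funpow_fst funpow_add)
    finally have main: "(LINT z|\<mu>. \<psi> ((skew G ^^ n) z) * \<phi> z) = (LINT z|\<mu>. H (fst z) * \<phi> ((skew G ^^ n) z))" .

    have "AE z in \<mu>. good (fst z)" using AE_distrD[OF fst\<mu>] AE_good unfolding \<mu>(4) by blast
    then have near: "AE z in \<mu>. \<bar>\<phi> ((skew G ^^ n) z) - \<Phi> (fst z)\<bar> \<le> b * \<alpha> ^ n"
    proof eventually_elim
      case (elim z)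
      then have z: "fst z \<in> space m" by (simp add: good_def)
      have d0: "dtheta \<theta> x x = 0" for x :: "nat \<Rightarrow> 'n" by (simp add: dtheta_def)
      have "\<bar>\<phi> ((skew G ^^ n) z) - \<Phi> (fst z)\<bar>
          \<le> b * dist (snd ((skew G ^^ n) z)) (snd ((skew G ^^ n) (fst z, y0)))"
        using lip[of "(skew G ^^ n) z" "(skew G ^^ n) (fst z, y0)"] iter_in z
        by (simp add: \<Phi>_def skew_funpow_fst d0 left_shift_funpow_in)
      also have "\<dots> \<le> b * \<alpha> ^ n"
        using fibre_contraction[OF elim, of n "snd z" y0] b0 by (intro mult_left_mono) auto
      finally show ?case .
    qed
    have bd: "AE z in \<mu>. \<bar>\<phi> ((skew G ^^ n) z)\<bar> \<le> b" "AE z in \<mu>. \<bar>\<Phi> (fst z)\<bar> \<le> b"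
      by (intro AE_I2; auto simp: space\<mu> intro!: b iter_in \<Phi>_le)+
    have meas: "(\<lambda>z. \<phi> ((skew G ^^ n) z)) \<in> borel_measurable \<mu>" "(\<lambda>z. \<Phi> (fst z)) \<in> borel_measurable \<mu>"
      unfolding measurable_\<mu> by measurable
    have "\<bar>(LINT z|\<mu>. H (fst z) * \<phi> ((skew G ^^ n) z)) - (LINT z|\<mu>. H (fst z) * \<Phi> (fst z))\<bar>
        \<le> b * \<alpha> ^ n * (LINT z|\<mu>. \<bar>H (fst z)\<bar>)"
      by (rule integral_mult_diff_le[OF H\<mu> meas bd near])
    then have e1: "\<bar>(LINT z|\<mu>. H (fst z) * \<phi> ((skew G ^^ n) z)) - (LINT x|m. H x * \<Phi> x)\<bar> \<le> b * \<alpha> ^ n * I"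
      by (simp add: push[of "\<lambda>x. H x * \<Phi> x"] push[of "\<lambda>x. \<bar>H x\<bar>"] intH)
    \<comment> \<open>The same comparison with weight 1 in place of \<open>H\<close> handles the
      integral of \<open>\<phi>\<close> alone.\<close>
    have "\<bar>(LINT z|\<mu>. 1 * \<phi> ((skew G ^^ n) z)) - (LINT z|\<mu>. 1 * \<Phi> (fst z))\<bar> \<le> b * \<alpha> ^ n * (LINT z|\<mu>. \<bar>1\<bar>)"
      by (rule integral_mult_diff_le[OF _ meas bd near]) simp
    then have "\<bar>(LINT z|\<mu>. \<phi> z) - (LINT x|m. \<Phi> x)\<bar> \<le> b * \<alpha> ^ n"
      using push[of \<Phi>] inv[of \<phi>] by (simp add: \<mu>.prob_space)
    then have "\<bar>LINT x|m. h x\<bar> * \<bar>(LINT z|\<mu>. \<phi> z) - (LINT x|m. \<Phi> x)\<bar> \<le> I * (b * \<alpha> ^ n)"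
      unfolding I_def by (intro mult_mono integral_abs_bound) auto
    then have e2: "\<bar>(LINT x|m. h x) * (LINT z|\<mu>. \<phi> z) - (LINT x|m. h x) * (LINT x|m. \<Phi> x)\<bar> \<le> b * \<alpha> ^ n * I"
      by (simp add: right_diff_distrib mult_ac flip: abs_mult)

    \<comment> \<open>Only \<open>x\<close> has to be good, which matches the asymmetric oscillation
      condition of the decay estimate on the base.\<close>
    have "AE x in m. \<forall>x'\<in>space m. (\<forall>i\<le>n + l. x i = x' i) \<longrightarrow> \<bar>\<Phi> x - \<Phi> x'\<bar> \<le> b * (K' * \<theta> ^ l)"
      using AE_good
    proof (eventually_elim, intro ballI impI)
      fix x x' assume x: "good x" "x' \<in> space m" "\<forall>i\<le>n + l. x i = x' i"
      have xs: "x \<in> space m" using x(1) by (simp add: good_def)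
      have "\<bar>\<Phi> x - \<Phi> x'\<bar> \<le> b * (dtheta \<theta> ((left_shift ^^ n) x) ((left_shift ^^ n) x')
          + dist (snd ((skew G ^^ n) (x, y0))) (snd ((skew G ^^ n) (x', y0))))"
        using lip[OF iter_in iter_in, of "(x, y0)" "(x', y0)"] xs x(2) by (simp add: \<Phi>_def skew_funpow_fst)
      also have "\<dots> \<le> b * (\<theta> ^ l / (1 - \<theta>) + K * \<theta> ^ l)"
        using x b0 by (intro mult_left_mono add_mono dtheta_funpow_le base_variation) auto
      finally show "\<bar>\<Phi> x - \<Phi> x'\<bar> \<le> b * (K' * \<theta> ^ l)" by (simp add: K'_def algebra_simps)
    qed
    from decay[OF \<Phi> h \<Phi>_le this, of q]
    have e3: "\<bar>(LINT x|m. H x * \<Phi> x) - (LINT x|m. h x) * (LINT x|m. \<Phi> x)\<bar>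
        \<le> (2 * (b * (K' * \<theta> ^ l)) + b * C * \<rho> ^ q) * I"
      unfolding lq(4) H_def I_def by simp

    have "\<theta> ^ l \<le> \<beta> ^ l" using \<theta> \<beta> by (intro power_mono) auto
    moreover have "\<rho> ^ q \<le> \<beta> ^ l"
      using \<rho> \<beta> lq by (intro order_trans[OF power_mono[of \<rho> \<beta> q] power_decreasing[of l q \<beta>]]) auto
    moreover have "\<alpha> ^ n \<le> \<beta> ^ l"
      using \<alpha> \<beta> lq by (intro order_trans[OF power_mono[of \<alpha> \<beta> n] power_decreasing[of l n \<beta>]]) auto
    ultimately have "2 * \<alpha> ^ n + 2 * (K' * \<theta> ^ l) + C * \<rho> ^ q \<le> 2 * \<beta> ^ l + 2 * (K' * \<beta> ^ l) + C * \<beta> ^ l"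
      using K' C by (intro add_mono mult_left_mono) auto
    also have "\<dots> = (2 + 2 * K' + C) * \<beta> ^ l" by (simp add: algebra_simps)
    also have "\<dots> \<le> C' * sqrt \<beta> ^ n"
    proof -
      have "\<beta> ^ l * \<beta> = sqrt \<beta> ^ (2 * l + 2)"
        using \<beta> by (simp add: power_add power_mult)
      also have "\<dots> \<le> sqrt \<beta> ^ n" using \<beta> lq by (intro power_decreasing) auto
      finally have "\<beta> ^ l \<le> sqrt \<beta> ^ n / \<beta>" using \<beta> by (simp add: field_simps)
      then have "(2 + 2 * K' + C) * \<beta> ^ l \<le> (2 + 2 * K' + C) * (sqrt \<beta> ^ n / \<beta>)"
        using K' C by (intro mult_left_mono) auto
      then show ?thesis by (simp add: C'_def)
    qed
    finally have rate: "2 * \<alpha> ^ n + 2 * (K' * \<theta> ^ l) + C * \<rho> ^ q \<le> C' * sqrt \<beta> ^ n" .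
    have "\<bar>(LINT z|\<mu>. \<psi> ((skew G ^^ n) z) * \<phi> z) - (LINT z|\<mu>. \<psi> z) * (LINT z|\<mu>. \<phi> z)\<bar>
        \<le> b * \<alpha> ^ n * I + b * \<alpha> ^ n * I + (2 * (b * (K' * \<theta> ^ l)) + b * C * \<rho> ^ q) * I"
      unfolding main \<psi>h using e1 e2 e3 by linarith
    also have "\<dots> = (2 * \<alpha> ^ n + 2 * (K' * \<theta> ^ l) + C * \<rho> ^ q) * (b * I)" by (simp add: algebra_simps)
    also have "\<dots> \<le> C' * sqrt \<beta> ^ n * (b * I)" using rate b0 I by (intro mult_right_mono) auto
    finally show "\<bar>(LINT z|\<mu>. \<psi> ((skew G ^^ n) z) * \<phi> z) - (LINT z|\<mu>. \<psi> z) * (LINT z|\<mu>. \<phi> z)\<bar>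
        \<le> sqrt \<beta> ^ n * (C' * (LINT x|m. \<bar>h x\<bar>) * b)"
      by (simp add: I_def mult_ac)
  qed (use \<beta> K' C in \<open>auto simp: C'_def\<close>)
qed

end

text \<open>\<open>fst\<close> intertwines \<open>skew G\<close> with \<open>left_shift\<close>, so
  the marginal is shift invariant; membership in \<open>S_infty\<close> supplies its Lipschitz
  density.\<close>

lemma (in markov_shift) marginal_eq:
  fixes \<mu> :: "((nat \<Rightarrow> 'n) \<times> 'k::polish_space) measure"
  assumes \<theta>: "0 < \<theta>" "\<theta> < 1" and sets: "sets \<mu> = sets (m \<Otimes>\<^sub>M borel)" and "prob_space \<mu>"
    and inv: "distr \<mu> \<mu> (skew G) = \<mu>" and G: "skew G \<in> \<mu> \<rightarrow>\<^sub>M \<mu>"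
    and S: "measure \<mu> \<in> S_infty \<theta> A m"
  shows "distr \<mu> m fst = m"
proof -
  interpret \<mu>: prob_space \<mu> by fact
  have fst: "fst \<in> \<mu> \<rightarrow>\<^sub>M m" using measurable_cong_sets[OF sets refl] measurable_fst by blast
  have space: "space \<mu> = space m \<times> UNIV"
    using sets_eq_imp_space_eq[OF sets] by (simp add: space_pair_measure)
  obtain f L where L: "lip_bound (shift_space A) (dtheta \<theta>) f L" and f: "integrable m f"
    and dens: "\<And>E. E \<in> sets m \<Longrightarrow> measure \<mu> (E \<times> UNIV) = (LINT x:E|m. f x)"
    using S unfolding S_infty_def F_theta_def lip_functions_def signed_density_def by blast
  show ?thesis
  proof (rule invariant_lipschitz_density_eq[OF \<theta> L f])
    show "prob_space (distr \<mu> m fst)" by (rule \<mu>.prob_space_distr[OF fst])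
    show "measure (distr \<mu> m fst) E = (LINT x:E|m. f x)" if "E \<in> sets m" for E
    proof -
      have "fst -` E \<inter> space \<mu> = E \<times> UNIV" using sets.sets_into_space[OF that] by (auto simp: space)
      then show ?thesis using dens[OF that] by (simp add: measure_distr[OF fst that])
    qed
    have "distr (distr \<mu> m fst) m left_shift = distr \<mu> m (left_shift \<circ> fst)"
      by (rule distr_distr[OF measurable_left_shift fst])
    also have "left_shift \<circ> fst = fst \<circ> skew G" by (auto simp: skew_def)
    also have "distr \<mu> m (fst \<circ> skew G) = distr (distr \<mu> \<mu> (skew G)) m fst"
      by (rule distr_distr[OF fst G, symmetric])
    finally show "distr (distr \<mu> m fst) (distr \<mu> m fst) left_shift = distr \<mu> m fst"
      by (simp add: inv cong: distr_cong)
  qed simp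
qed

section \<open>Exponential decay of correlations under (G1) and (G2)\<close>

theorem theorem2:
  fixes A :: "nat^'n^'n"
    and \<theta> :: real
    and m :: "(nat \<Rightarrow> 'n) measure"
    and G :: "(nat \<Rightarrow> 'n) \<times> 'k::polish_space \<Rightarrow> 'k"
    and \<mu>\<^sub>0 :: "((nat \<Rightarrow> 'n) \<times> 'k) measure"
  assumes "zero_one_matrix A" and "aperiodic A"
    and "0 < \<theta>" and "\<theta> < 1"
    and "markov_measure A m" and "distr m m left_shift = m"
    and "compact (UNIV :: 'k set)" and "diameter (UNIV :: 'k set) = 1"
    and "G \<in> skew_borel A \<rightarrow>\<^sub>M borel"
    and "G1 m G" and "G2 \<theta> A G"
    and "sets \<mu>\<^sub>0 = sets (skew_borel A)" and "prob_space \<mu>\<^sub>0"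
    and "distr \<mu>\<^sub>0 \<mu>\<^sub>0 (skew G) = \<mu>\<^sub>0"
    and "measure \<mu>\<^sub>0 \<in> S_infty \<theta> A m"
  shows "\<exists>\<tau>\<^sub>2. 0 < \<tau>\<^sub>2 \<and> \<tau>\<^sub>2 < 1 \<and>
    (\<exists>D :: real \<Rightarrow> real \<Rightarrow> real. (\<forall>a b. 0 < D a b) \<and>
      (\<forall>\<psi> h \<phi>.
        (\<forall>x\<in>shift_space A. \<forall>y. \<psi> (x, y) = h x) \<longrightarrow> integrable m h \<longrightarrow>
        \<phi> \<in> H_space \<theta> A \<longrightarrow>
        (\<forall>n\<ge>1.
          \<bar>(LINT z|\<mu>\<^sub>0. \<psi> ((skew G ^^ n) z) * \<phi> z) - (LINT z|\<mu>\<^sub>0. \<psi> z) * (LINT z|\<mu>\<^sub>0. \<phi> z)\<bar>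
            \<le> \<tau>\<^sub>2 ^ n * D (LINT x|m. \<bar>h x\<bar>) (H_norm \<theta> A \<phi>))))"
proof -
  obtain p P where "\<forall>i. 0 \<le> p $ i" "(\<Sum>i\<in>UNIV. p $ i) = 1" "\<forall>i j. 0 \<le> P $ i $ j"
    "\<forall>i. (\<Sum>j\<in>UNIV. P $ i $ j) = 1" "\<forall>i j. 0 < P $ i $ j \<longleftrightarrow> A $ i $ j = 1"
    "\<forall>w k. measure m {x \<in> shift_space A. \<forall>i\<le>k. x i = w i} = p $ w 0 * (\<Prod>i<k. P $ w i $ w (Suc i))"
    and m: "sets m = sets (shift_borel A)" "prob_space m"
    using assms(5) unfolding markov_measure_def by blast
  then interpret markov_shift A p P m
    using assms(1,2,6) by (intro markov_shift.intro markov_shift_axioms.intro) auto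
  obtain \<alpha> where \<alpha>: "0 < \<alpha>" "\<alpha> < 1"
    "AE x in m. \<forall>y1 y2. dist (G (x, y1)) (G (x, y2)) \<le> \<alpha> * dist y1 y2"
    using assms(10) unfolding G1_def by blast
  obtain k where k: "\<And>y. 0 \<le> k y" "bdd_above (range k)"
    "\<And>y x1 x2. x1 \<in> shift_space A \<Longrightarrow> x2 \<in> shift_space A \<Longrightarrow>
      dist (G (x1, y)) (G (x2, y)) \<le> k y * dtheta \<theta> x1 x2"
    using assms(11) unfolding G2_def by blast
  obtain c where c: "\<And>y. k y \<le> c" using k(2) unfolding bdd_above_def by blast
  have diam: "dist y1 y2 \<le> 1" for y1 y2 :: 'k
    using diameter_bounded_bound[OF compact_imp_bounded[OF assms(7)]] assms(8) by simp
  have sets: "sets (skew_borel A) = sets (m \<Otimes>\<^sub>M (borel :: 'k measure))"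
    unfolding skew_borel_def by (intro sets_pair_measure_cong m(1)[symmetric] refl)
  have G: "G \<in> m \<Otimes>\<^sub>M borel \<rightarrow>\<^sub>M borel"
    using assms(9) by (simp only: measurable_cong_sets[OF sets refl])
  interpret contracting_skew_product A p P m \<theta> \<alpha> c G
  proof unfold_locales
    show "dist (G (x1, y)) (G (x2, y)) \<le> c * dtheta \<theta> x1 x2" if "x1 \<in> space m" "x2 \<in> space m" for x1 x2 y
      using k(3)[of x1 x2 y] that mult_right_mono[OF c[of y] dtheta_nonneg[OF assms(3,4), of x1 x2]]
      by (simp add: space_eq)
    show "0 \<le> c" using k(1) c by (rule order_trans)
  qed (use assms(3,4) \<alpha> diam G in auto)
  have \<mu>: "sets \<mu>\<^sub>0 = sets (m \<Otimes>\<^sub>M borel)" using assms(12) sets by simp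
  have F: "skew G \<in> \<mu>\<^sub>0 \<rightarrow>\<^sub>M \<mu>\<^sub>0"
    by (simp only: measurable_cong_sets[OF \<mu> \<mu>] measurable_skew)
  have marginal: "distr \<mu>\<^sub>0 m fst = m"
    by (rule marginal_eq[OF assms(3,4) \<mu> assms(13,14) F assms(15)])
  obtain \<tau> C where \<tau>: "0 < \<tau>" "\<tau> < 1" "0 \<le> C" and decay:
    "\<And>(\<psi> :: _ \<times> 'k \<Rightarrow> real) h (\<phi> :: _ \<times> 'k \<Rightarrow> real) b n. \<lbrakk>\<And>x y. x \<in> space m \<Longrightarrow> \<psi> (x, y) = h x; integrable m h;
       lip_bound (shift_space A \<times> UNIV) (skew_dist \<theta>) \<phi> b; \<And>z. fst z \<in> space m \<Longrightarrow> \<bar>\<phi> z\<bar> \<le> b; n \<ge> 1\<rbrakk> \<Longrightarrow>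
       \<bar>(LINT z|\<mu>\<^sub>0. \<psi> ((skew G ^^ n) z) * \<phi> z) - (LINT z|\<mu>\<^sub>0. \<psi> z) * (LINT z|\<mu>\<^sub>0. \<phi> z)\<bar>
         \<le> \<tau> ^ n * (C * (LINT x|m. \<bar>h x\<bar>) * b)"
    by (rule skew_decay_of_correlations[OF assms(13) \<mu> assms(14) marginal]) blast
  \<comment> \<open>The absolute value and the added 1 make \<open>D\<close> positive at all real
    arguments.\<close>
  define D where "D a b = \<bar>C * a * b\<bar> + 1" for a b
  have dist_le: "0 \<le> skew_dist \<theta> u v \<and> skew_dist \<theta> u v \<le> 1 / (1 - \<theta>) + 1" for u v :: "_ \<times> 'k"
    using dtheta_nonneg[OF assms(3,4), of "fst u" "fst v"] dtheta_le[OF assms(3,4), of 0 "fst u" "fst v"]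
      diam[of "snd u" "snd v"] by (simp add: skew_dist_def)
  have ne: "shift_space A \<times> (UNIV :: 'k set) \<noteq> {}" using not_empty by (simp add: space_eq)
  have "\<bar>(LINT z|\<mu>\<^sub>0. \<psi> ((skew G ^^ n) z) * \<phi> z) - (LINT z|\<mu>\<^sub>0. \<psi> z) * (LINT z|\<mu>\<^sub>0. \<phi> z)\<bar>
      \<le> \<tau> ^ n * D (LINT x|m. \<bar>h x\<bar>) (H_norm \<theta> A \<phi>)"
    if \<psi>: "\<forall>x\<in>shift_space A. \<forall>y. \<psi> (x, y) = h x" and h: "integrable m h"
      and \<phi>: "\<phi> \<in> H_space \<theta> A" and n: "n \<ge> 1" for \<psi> h \<phi> n
  proof -
    \<comment> \<open>\<open>H_norm\<close> plays the role of \<open>b\<close>, bounding the values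
      and the Lipschitz constant at once.\<close>
    note b = lip_norm_bounds[OF ne dist_le \<phi>[unfolded H_space_def], folded H_norm_def]
    have "\<bar>(LINT z|\<mu>\<^sub>0. \<psi> ((skew G ^^ n) z) * \<phi> z) - (LINT z|\<mu>\<^sub>0. \<psi> z) * (LINT z|\<mu>\<^sub>0. \<phi> z)\<bar>
        \<le> \<tau> ^ n * (C * (LINT x|m. \<bar>h x\<bar>) * H_norm \<theta> A \<phi>)"
    proof (rule decay[OF _ h b(2) _ n])
      show "\<psi> (x, y) = h x" if "x \<in> space m" for x y using \<psi> that by (simp add: space_eq)
      show "\<bar>\<phi> z\<bar> \<le> H_norm \<theta> A \<phi>" if "fst z \<in> space m" for z
        using that by (intro b(1)) (simp add: space_eq mem_Times_iff)
    qed
    also have "\<dots> \<le> \<tau> ^ n * D (LINT x|m. \<bar>h x\<bar>) (H_norm \<theta> A \<phi>)"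
      using \<tau> by (intro mult_left_mono) (auto simp: D_def)
    finally show ?thesis .
  qed
  moreover have "0 < D a b" for a b by (simp add: D_def add_nonneg_pos)
  ultimately show ?thesis using \<tau>(1,2) by blast
qed

end
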